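(* Let $m,n$ be positive integers with $1\le m\le n-2$, let $p\in(n-m,\infty)$, $\beta=\frac{p-n+m}{p-1}$, and suppose that $0<\gamma<\beta$. Write $x=(x',x'')\in\mathbf{R}^{n-m}\times\mathbf{R}^m$. Then there exists $\delta_c\in(0,1)$, depending only on $n$, $\gamma$ and $p$, such that in the open set $\{x\in\mathbf{R}^n: |x''|<1,\ 0<|x'|<\delta_c\}$ the function $$\hat u(x)=|x'|^\beta+|x''|^2|x'|^\gamma-\tfrac12|x'|^2$$ is a supersolution, and the function $$\check u(x)=(1-|x''|^2)|x'|^\beta+|x'|$$ is a subsolution, to the $p$-Laplace equation. Moreover, if $\gamma>1/2$ then $\delta_c$ can be chosen independent of $p$ if $p$ is large.
   Context: Here $x'=(x_1,\dots,x_{n-m})$ and $x''=(x_{n-m+1},\dots,x_n)$. For an open set $G$ and $p\in(1,\infty)$, $u\in W^{1,p}_{loc}(G)$ is a (weak) subsolution (supersolution) to the $p$-Laplace equation $\nabla\cdot(|\nabla u|^{p-2}\nabla u)=0$ in $G$ if $\int_G|\nabla u|^{p-2}\langle\nabla u,\nabla\theta\rangle\,dx\le 0$ ($\ge 0$) for all non-negative $\theta\in C_0^\infty(G)$. "$\delta_c$ can be chosen independent of $p$ if $p$ is large" means: for fixed $n$ and $\gamma$ there is $p_0$ such that for all finite $p\ge p_0$ (with $\gamma<\beta$) one value of $\delta_c$, depending only on $n$ and $\gamma$, works. *)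

theory Defs
  imports "HOL-Analysis.Analysis"
begin

text \<open>
  The space \<open>\<real>\<^sup>n\<close> is \<^typ>\<open>real ^ 'n\<close> with \<open>n = CARD('n)\<close>. The index type carries a linear order, so that
  the coordinates can be numbered \<open>1, \<dots>, n\<close>; finite linear orders of equal size are isomorphic, hence
  nothing depends on the choice of \<open>'n\<close> beyond its cardinality.
\<close>

definition coord_num :: "'n::{finite,linorder} \<Rightarrow> nat" where
  "coord_num i = card {j. j \<le> i}"

text \<open>\<open>x' = (x\<^sub>1, \<dots>, x\<^sub>n\<^sub>-\<^sub>m)\<close> and \<open>x'' = (x\<^sub>n\<^sub>-\<^sub>m\<^sub>+\<^sub>1, \<dots>, x\<^sub>n)\<close>, both padded with zeros to vectors of \<open>\<real>\<^sup>n\<close>.\<close>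

definition fst_part :: "nat \<Rightarrow> real ^ 'n::{finite,linorder} \<Rightarrow> real ^ 'n::{finite,linorder}" where
  "fst_part m x = (\<chi> i. if coord_num i \<le> CARD('n) - m then x $ i else 0)"

definition snd_part :: "nat \<Rightarrow> real ^ 'n::{finite,linorder} \<Rightarrow> real ^ 'n::{finite,linorder}" where
  "snd_part m x = (\<chi> i. if CARD('n) - m < coord_num i then x $ i else 0)"


definition partial_deriv :: "'n \<Rightarrow> (real ^ 'n::finite \<Rightarrow> real) \<Rightarrow> real ^ 'n \<Rightarrow> real" where
  "partial_deriv i f x = frechet_derivative f (at x) (axis i 1)"

definition grad :: "(real ^ 'n::finite \<Rightarrow> real) \<Rightarrow> real ^ 'n \<Rightarrow> real ^ 'n" where
  "grad f x = (\<chi> i. partial_deriv i f x)"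

primrec C_k :: "nat \<Rightarrow> (real ^ 'n::finite \<Rightarrow> real) \<Rightarrow> bool" where
  "C_k 0 f \<longleftrightarrow> continuous_on UNIV f"
| "C_k (Suc k) f \<longleftrightarrow> (\<forall>x. f differentiable (at x)) \<and> (\<forall>i. C_k k (partial_deriv i f))"

text \<open>Elements of \<open>C\<^sub>0\<^sup>\<infinity>(G)\<close> are regarded as functions on \<open>\<real>\<^sup>n\<close>, extended by zero outside \<open>G\<close>.\<close>

definition test_functions :: "(real ^ 'n::finite) set \<Rightarrow> (real ^ 'n \<Rightarrow> real) set" where
  "test_functions G = {\<theta>. (\<forall>k. C_k k \<theta>) \<and> compact (closure {x. \<theta> x \<noteq> 0}) \<and> closure {x. \<theta> x \<noteq> 0} \<subseteq> G}"

definition Lp_loc ::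
  "real \<Rightarrow> (real ^ 'n::finite) set \<Rightarrow> (real ^ 'n \<Rightarrow> 'b::euclidean_space) set" where
  "Lp_loc p G = {f. f \<in> borel_measurable (lebesgue_on G) \<and>
     (\<forall>K. compact K \<and> K \<subseteq> G \<longrightarrow> integrable (lebesgue_on K) (\<lambda>x. norm (f x) powr p))}"

definition weak_gradient ::
  "(real ^ 'n::finite) set \<Rightarrow> (real ^ 'n \<Rightarrow> real) \<Rightarrow> (real ^ 'n \<Rightarrow> real ^ 'n) \<Rightarrow> bool" where
  "weak_gradient G u Du \<longleftrightarrow> (\<forall>\<phi>\<in>test_functions G. \<forall>i.
     (LINT x|lebesgue_on G. u x * partial_deriv i \<phi> x) = - (LINT x|lebesgue_on G. Du x $ i * \<phi> x))"

text \<open>\<open>u \<in> W\<^sup>1\<^sup>,\<^sup>p\<^sub>l\<^sub>o\<^sub>c(G)\<close> with weak gradient \<open>Du\<close>, which is determined by \<open>u\<close> up to a null set.\<close>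

definition W1p_loc_with_gradient ::
  "real \<Rightarrow> (real ^ 'n::finite) set \<Rightarrow> (real ^ 'n \<Rightarrow> real) \<Rightarrow> (real ^ 'n \<Rightarrow> real ^ 'n) \<Rightarrow> bool" where
  "W1p_loc_with_gradient p G u Du \<longleftrightarrow> u \<in> Lp_loc p G \<and> Du \<in> Lp_loc p G \<and> weak_gradient G u Du"

text \<open>
  The choice of \<open>Du\<close> is immaterial. At zeros of \<open>Du\<close> the integrand vanishes, which is the
  usual convention for the field \<open>|\<nabla>u|\<^sup>p\<^sup>-\<^sup>2 \<nabla>u\<close>.
\<close>

definition p_subsolution :: "real \<Rightarrow> (real ^ 'n::finite) set \<Rightarrow> (real ^ 'n \<Rightarrow> real) \<Rightarrow> bool" where
  "p_subsolution p G u \<longleftrightarrow> (\<exists>Du. W1p_loc_with_gradient p G u Du \<and>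
     (\<forall>\<theta>\<in>test_functions G. (\<forall>x. 0 \<le> \<theta> x) \<longrightarrow>
        (LINT x|lebesgue_on G. norm (Du x) powr (p - 2) * (Du x \<bullet> grad \<theta> x)) \<le> 0))"

definition p_supersolution :: "real \<Rightarrow> (real ^ 'n::finite) set \<Rightarrow> (real ^ 'n \<Rightarrow> real) \<Rightarrow> bool" where
  "p_supersolution p G u \<longleftrightarrow> (\<exists>Du. W1p_loc_with_gradient p G u Du \<and>
     (\<forall>\<theta>\<in>test_functions G. (\<forall>x. 0 \<le> \<theta> x) \<longrightarrow>
        (LINT x|lebesgue_on G. norm (Du x) powr (p - 2) * (Du x \<bullet> grad \<theta> x)) \<ge> 0))"


definition beta_exp :: "nat \<Rightarrow> nat \<Rightarrow> real \<Rightarrow> real" where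
  "beta_exp n m p = (p - real n + real m) / (p - 1)"

definition dom_G :: "nat \<Rightarrow> real \<Rightarrow> (real ^ 'n::{finite,linorder}) set" where
  "dom_G m \<delta> = {x. norm (snd_part m x) < 1 \<and> 0 < norm (fst_part m x) \<and> norm (fst_part m x) < \<delta>}"

definition u_hat :: "nat \<Rightarrow> real \<Rightarrow> real \<Rightarrow> real ^ 'n::{finite,linorder} \<Rightarrow> real" where
  "u_hat m p \<gamma> x = norm (fst_part m x) powr beta_exp CARD('n) m p
     + (norm (snd_part m x))\<^sup>2 * norm (fst_part m x) powr \<gamma> - 1 / 2 * (norm (fst_part m x))\<^sup>2"

definition u_check :: "nat \<Rightarrow> real \<Rightarrow> real ^ 'n::{finite,linorder} \<Rightarrow> real" where
  "u_check m p x = (1 - (norm (snd_part m x))\<^sup>2) * norm (fst_part m x) powr beta_exp CARD('n) m p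
     + norm (fst_part m x)"

end

theory Submission
  imports Defs
begin

text \<open>
  Write \<open>k = n - m\<close>, \<open>r = |x'|\<close>, \<open>\<rho> = r\<^sup>2\<close> and \<open>\<sigma> = |x''|\<^sup>2\<close>. On the set in question both functions are
  smooth functions of \<open>\<rho>\<close> and \<open>\<sigma>\<close> with nonvanishing gradient. Integration by parts
  (\<open>integration_by_parts_test_function\<close>) therefore shows that the classical gradient is the weak
  one, and that a function of this kind is a weak sub- or supersolution as soon as its \<open>p\<close>-Laplacian has
  the right sign at every point (\<open>biradial_p_subsolution_p_supersolution\<close>). For \<open>\<nabla>u = a x' + b x''\<close> the sign
  is that of \<open>|\<nabla>u|\<^sup>2 \<Delta>u + (p - 2) \<langle>D\<^sup>2u \<nabla>u, \<nabla>u\<rangle>\<close>, an explicit expression in \<open>r\<close> and \<open>\<sigma>\<close>.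

  The exponent \<open>\<beta>\<close> is the one for which \<open>r\<^sup>\<beta>\<close> is \<open>p\<close>-harmonic in \<open>\<real>\<^sup>k\<close>, so the most singular term cancels
  and the next one decides. For the supersolution, \<open>\<sigma> r\<^sup>\<gamma>\<close> with \<open>\<gamma> < \<beta>\<close> contributes a negative multiple of
  \<open>(p - 1)(\<beta> - \<gamma>) \<sigma> r\<^sup>\<gamma>\<^sup>-\<^sup>2\<close>, which outweighs all error terms containing \<open>\<sigma>\<close> when \<open>r\<close> is small, while
  \<open>-r\<^sup>2/2\<close> contributes a negative constant that absorbs the Laplacian in \<open>x''\<close>; the latter is
  of size \<open>r\<^sup>\<gamma>\<close> and survives at \<open>\<sigma> = 0\<close> (\<open>p_laplace_form_u_hat_nonpos\<close>). For the subsolution, the summand \<open>r\<close>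
  contributes the positive term \<open>(k - 1)/r\<close>; here \<open>k \<ge> 2\<close> is essential
  (\<open>p_laplace_form_u_check_nonneg\<close>).

  For the supersolution the decisive term and the bounds for the error terms containing \<open>\<sigma>\<close> have the
  same factor \<open>p - 1\<close>, and for the subsolution \<open>p\<close> enters only through \<open>r \<le> \<beta>\<close>. So the admissible
  radius depends only on \<open>n\<close>, \<open>\<gamma>\<close> and a lower bound for \<open>\<beta> - \<gamma>\<close> (\<open>barrier_radius\<close>). For a given \<open>p\<close> such a bound exists because \<open>m\<close> takes finitely many values. For
  large \<open>p\<close> it exists because \<open>\<beta>\<close> tends to \<open>1\<close> and \<open>\<gamma> < \<beta> < 1\<close>.
\<close>

section \<open>Integration by parts against test functions\<close>

lemma directional_difference_quotient_tendsto:
  fixes F :: "'a::real_normed_vector \<Rightarrow> real"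
  assumes "(F has_derivative F') (at x)"
  shows "(\<lambda>j. (F (x + inverse (real (Suc j)) *\<^sub>R e) - F x) / inverse (real (Suc j))) \<longlonglongrightarrow> F' e"
proof -
  have lin: "bounded_linear F'"
    using assms by (rule has_derivative_bounded_linear)
  have "((\<lambda>t::real. x + t *\<^sub>R e) has_derivative (\<lambda>t. t *\<^sub>R e)) (at 0)"
    by (auto intro!: derivative_eq_intros)
  then have "((\<lambda>t::real. F (x + t *\<^sub>R e)) has_derivative (\<lambda>t. F' (t *\<^sub>R e))) (at 0)"
    by (rule has_derivative_compose) (use assms in simp)
  then have "((\<lambda>t::real. F (x + t *\<^sub>R e)) has_real_derivative F' e) (at 0)"
    by (rule has_derivative_imp_has_field_derivative)
      (simp add: linear_cmul[OF bounded_linear.linear[OF lin]])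
  then have "((\<lambda>h. (F (x + h *\<^sub>R e) - F x) / h) \<longlongrightarrow> F' e) (at 0)"
    by (simp add: DERIV_def)
  moreover have "filterlim (\<lambda>j. inverse (real (Suc j))) (at 0) sequentially"
    using LIMSEQ_inverse_real_of_nat by (simp add: filterlim_at)
  ultimately show ?thesis
    by (rule filterlim_compose)
qed

text \<open>Translation invariance makes every difference quotient of \<open>F\<close> integrate to zero, and the mean value
  theorem bounds the quotients by a constant on one fixed ball, so dominated convergence passes to the
  derivative.\<close>

lemma integral_directional_derivative_eq_0:
  fixes F :: "'a::euclidean_space \<Rightarrow> real"
  assumes der: "\<And>x. (F has_derivative F' x) (at x)"
    and K: "compact K" and off: "\<And>x. x \<notin> K \<Longrightarrow> F x = 0"
    and bd: "\<And>x. \<bar>F' x e\<bar> \<le> M"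
  shows "(LINT x|lborel. F' x e) = 0"
proof -
  define h where "h j = inverse (real (Suc j))" for j
  have h: "0 < h j" "h j \<le> 1" for j
    by (auto simp: h_def field_simps)
  define D where "D j x = (F (x + h j *\<^sub>R e) - F x) / h j" for j x
  have contF: "continuous_on UNIV F"
    using der has_derivative_continuous_on has_derivative_at_withinI by blast
  have [measurable]: "F \<in> borel_measurable borel"
    using contF by (rule borel_measurable_continuous_onI)
  have [measurable]: "D j \<in> borel_measurable borel" for j
    unfolding D_def by measurable
  have lim: "(\<lambda>j. D j x) \<longlonglongrightarrow> F' x e" for x
    unfolding D_def h_def by (rule directional_difference_quotient_tendsto[OF der])
  have [measurable]: "(\<lambda>x. F' x e) \<in> borel_measurable borel"
    by (rule borel_measurable_LIMSEQ_real[OF lim]) simp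
  obtain R where R: "\<And>x. x \<in> K \<Longrightarrow> norm x \<le> R"
    using compact_imp_bounded[OF K] by (auto simp: bounded_iff)
  define S where "S = cball (0::'a) (R + norm e)"
  have D_bound: "norm (D j x) \<le> M * indicator S x" for j x
  proof (cases "x \<in> S")
    case True
    have "\<exists>t\<in>{0<..<h j}. norm (F (x + h j *\<^sub>R e) - F (x + 0 *\<^sub>R e))
        \<le> norm (F' (x + t *\<^sub>R e) ((h j - 0) *\<^sub>R e))"
    proof (rule mvt_general[OF h(1)])
      show "continuous_on {0..h j} (\<lambda>t. F (x + t *\<^sub>R e))"
        by (rule continuous_on_compose2[OF contF]) (auto intro!: continuous_intros)
      fix t
      have "((\<lambda>t::real. x + t *\<^sub>R e) has_derivative (\<lambda>t. t *\<^sub>R e)) (at t)"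
        by (auto intro!: derivative_eq_intros)
      then show "((\<lambda>t::real. F (x + t *\<^sub>R e)) has_derivative (\<lambda>s. F' (x + t *\<^sub>R e) (s *\<^sub>R e))) (at t)"
        by (rule has_derivative_compose[OF _ der])
    qed
    then obtain t where "norm (F (x + h j *\<^sub>R e) - F x) \<le> norm (F' (x + t *\<^sub>R e) (h j *\<^sub>R e))"
      by auto
    also have "F' (x + t *\<^sub>R e) (h j *\<^sub>R e) = h j * F' (x + t *\<^sub>R e) e"
      using linear_cmul[OF has_derivative_linear[OF der]] by simp
    also have "norm \<dots> \<le> h j * M"
      using h(1)[of j] bd by (simp add: abs_mult)
    finally show ?thesis
      using True h(1)[of j] by (simp add: D_def field_simps abs_mult)
  next
    case False
    then have far: "R + norm e < norm x"
      by (simp add: S_def)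
    then have "x \<notin> K"
      using R[of x] norm_ge_zero[of e] by linarith
    moreover have "x + h j *\<^sub>R e \<notin> K"
    proof
      assume "x + h j *\<^sub>R e \<in> K"
      then have "norm (x + h j *\<^sub>R e) \<le> R" by (rule R)
      moreover have "norm x \<le> norm (x + h j *\<^sub>R e) + norm (h j *\<^sub>R e)"
        by (metis add_diff_cancel_right' norm_triangle_ineq4)
      moreover have "norm (h j *\<^sub>R e) \<le> norm e"
        using h[of j] by (simp add: mult_left_le_one_le)
      ultimately show False using far by linarith
    qed
    ultimately show ?thesis
      using False by (simp add: D_def off)
  qed
  have intF: "integrable lborel F"
  proof -
    have "integrable lborel (\<lambda>x. indicator K x *\<^sub>R F x)"
      using K continuous_on_subset[OF contF] by (intro borel_integrable_compact) auto
    also have "(\<lambda>x. indicator K x *\<^sub>R F x) = F"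
      using off by (auto simp: indicator_def fun_eq_iff)
    finally show ?thesis .
  qed
  (* Translation invariance of Lebesgue measure: shifting F does not change its integral. *)
  have shift: "(LINT x|lborel. F (x + c)) = (LINT x|lborel. F x)"
    and shift_int: "integrable lborel (\<lambda>x. F (x + c))" for c
  proof -
    have "(LINT x|distr lborel borel ((+) c). F x) = (LINT x|lborel. F (c + x))"
      by (rule integral_distr) auto
    then show "(LINT x|lborel. F (x + c)) = (LINT x|lborel. F x)"
      by (simp add: lborel_distr_plus add.commute)
    have "integrable lborel (\<lambda>x. F (c + x))"
      by (rule integrable_distr[where M' = borel]) (auto simp: lborel_distr_plus intF)
    then show "integrable lborel (\<lambda>x. F (x + c))"
      by (simp add: add.commute)
  qed
  have D0: "(LINT x|lborel. D j x) = 0" for j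
    unfolding D_def using intF shift_int shift by simp
  have "(\<lambda>j. LINT x|lborel. D j x) \<longlonglongrightarrow> (LINT x|lborel. F' x e)"
  proof (rule integral_dominated_convergence)
    have "integrable lborel (\<lambda>x. indicator S x *\<^sub>R M)"
      by (rule borel_integrable_compact) (auto simp: S_def)
    then show "integrable lborel (\<lambda>x. M * indicator S x)"
      by (simp add: mult.commute)
  qed (use lim D_bound in auto)
  then show ?thesis
    by (simp only: D0 LIMSEQ_const_iff)
qed

text \<open>The product is continuous on \<open>K\<close> and zero elsewhere, hence Borel; this makes the completed measure on
  \<open>G\<close> interchangeable with Lebesgue--Borel measure on the whole space.\<close>

lemma integrable_times_compactly_supported:
  fixes h \<psi> :: "'a::euclidean_space \<Rightarrow> real"
  assumes G: "open G" and h: "continuous_on G h" and \<psi>: "continuous_on UNIV \<psi>"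
    and K: "compact K" "K \<subseteq> G" and off: "\<And>x. x \<notin> K \<Longrightarrow> \<psi> x = 0"
  shows "integrable lborel (\<lambda>x. h x * \<psi> x)"
    and "integrable (lebesgue_on G) (\<lambda>x. h x * \<psi> x)"
    and "(LINT x|lebesgue_on G. h x * \<psi> x) = (LINT x|lborel. h x * \<psi> x)"
proof -
  have "continuous_on K (\<lambda>x. h x * \<psi> x)"
    using continuous_on_subset[OF h K(2)] continuous_on_subset[OF \<psi>] by (intro continuous_intros) auto
  then have "integrable lborel (\<lambda>x. indicator K x *\<^sub>R (h x * \<psi> x))"
    using K by (intro borel_integrable_compact)
  also have "(\<lambda>x. indicator K x *\<^sub>R (h x * \<psi> x)) = (\<lambda>x. h x * \<psi> x)"
    using off by (auto simp: indicator_def fun_eq_iff)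
  finally show int: "integrable lborel (\<lambda>x. h x * \<psi> x)" .
  then have meas: "(\<lambda>x. h x * \<psi> x) \<in> borel_measurable lborel"
    by (rule borel_measurable_integrable)
  have ind: "(\<lambda>x. indicator G x *\<^sub>R (h x * \<psi> x)) = (\<lambda>x. h x * \<psi> x)"
    using off K by (auto simp: indicator_def fun_eq_iff)
  have Gs: "G \<inter> space lebesgue \<in> sets lebesgue"
    using G by (simp add: borel_open)
  show "integrable (lebesgue_on G) (\<lambda>x. h x * \<psi> x)"
    using int meas by (simp only: integrable_restrict_space[OF Gs] ind integrable_completion)
  show "(LINT x|lebesgue_on G. h x * \<psi> x) = (LINT x|lborel. h x * \<psi> x)"
    using meas by (simp only: integral_restrict_space[OF Gs] ind integral_completion)
qed

lemma test_functionD: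
  assumes "\<phi> \<in> test_functions G"
  shows "(\<phi> has_derivative frechet_derivative \<phi> (at x)) (at x)"
    and "continuous_on UNIV \<phi>"
    and "continuous_on UNIV (partial_deriv i \<phi>)"
    and "compact (closure {x. \<phi> x \<noteq> 0})" "closure {x. \<phi> x \<noteq> 0} \<subseteq> G"
    and "x \<notin> closure {x. \<phi> x \<noteq> 0} \<Longrightarrow> \<phi> x = 0"
    and "x \<notin> closure {x. \<phi> x \<noteq> 0} \<Longrightarrow> partial_deriv i \<phi> x = 0"
proof -
  have C: "C_k 0 \<phi>" "C_k (Suc 0) \<phi>"
    using assms unfolding test_functions_def by blast+
  show der: "(\<phi> has_derivative frechet_derivative \<phi> (at x)) (at x)"
    using C by (simp add: frechet_derivative_works)
  show "continuous_on UNIV \<phi>" "continuous_on UNIV (partial_deriv i \<phi>)"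
    using C by simp_all
  show "compact (closure {x. \<phi> x \<noteq> 0})" "closure {x. \<phi> x \<noteq> 0} \<subseteq> G"
    using assms by (auto simp: test_functions_def)
  show off: "x \<notin> closure {x. \<phi> x \<noteq> 0} \<Longrightarrow> \<phi> x = 0" for x
    using closure_subset[of "{x. \<phi> x \<noteq> 0}"] by blast
  show "partial_deriv i \<phi> x = 0" if "x \<notin> closure {x. \<phi> x \<noteq> 0}"
  proof -
    have "(\<phi> has_derivative (\<lambda>_. 0)) (at x)"
    proof (rule has_derivative_transform_within_open[of "\<lambda>_. 0" _ _ _ "- closure {x. \<phi> x \<noteq> 0}"])
      show "0 = \<phi> y" if "y \<in> - closure {x. \<phi> x \<noteq> 0}" for y
        using off[of y] that by (metis ComplD)
      show "x \<in> - closure {x. \<phi> x \<noteq> 0}"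
        using that by (simp only: Compl_iff not_False_eq_True)
    qed (rule has_derivative_const open_Compl[OF closed_closure])+
    then have "frechet_derivative \<phi> (at x) = (\<lambda>_. 0)"
      using der has_derivative_unique by blast
    then show ?thesis
      by (simp add: partial_deriv_def)
  qed
qed

text \<open>Off the support of \<open>\<phi>\<close> the product \<open>g \<phi>\<close> vanishes whatever the values of \<open>g\<close> outside \<open>G\<close>, so it
  is differentiable on the whole space and the integral of its partial derivative is zero.\<close>

lemma integration_by_parts_test_function:
  fixes g :: "real ^ 'n::finite \<Rightarrow> real"
  assumes G: "open G" and \<phi>: "\<phi> \<in> test_functions G"
    and der: "\<And>x. x \<in> G \<Longrightarrow> (g has_derivative g' x) (at x)"
    and cont: "continuous_on G (\<lambda>x. g' x (axis i 1))"
  shows "integrable (lebesgue_on G) (\<lambda>x. g x * partial_deriv i \<phi> x)"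
    and "integrable (lebesgue_on G) (\<lambda>x. g' x (axis i 1) * \<phi> x)"
    and "(LINT x|lebesgue_on G. g x * partial_deriv i \<phi> x) = - (LINT x|lebesgue_on G. g' x (axis i 1) * \<phi> x)"
proof -
  define K where "K = closure {x. \<phi> x \<noteq> 0}"
  note T = test_functionD[OF \<phi>, folded K_def]
  have contg: "continuous_on G g"
    using has_derivative_at_withinI[OF der] by (rule has_derivative_continuous_on)
  note A = integrable_times_compactly_supported[OF G contg T(3)[of i] T(4) T(5) T(7)[of _ i]]
  note B = integrable_times_compactly_supported[OF G cont T(2) T(4) T(5) T(6)]
  show "integrable (lebesgue_on G) (\<lambda>x. g x * partial_deriv i \<phi> x)"
    and "integrable (lebesgue_on G) (\<lambda>x. g' x (axis i 1) * \<phi> x)"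
    using A B by auto
  define F' where "F' x v =
    (if x \<in> G then g x * frechet_derivative \<phi> (at x) v + g' x v * \<phi> x else 0)" for x v
  have val: "F' x (axis i 1) = g x * partial_deriv i \<phi> x + g' x (axis i 1) * \<phi> x" for x
    using T(5) T(6)[of x] T(7)[of x i] by (cases "x \<in> K") (auto simp: F'_def partial_deriv_def)
  have "(LINT x|lborel. F' x (axis i 1)) = 0"
  proof -
    have "continuous_on K (\<lambda>x. F' x (axis i 1))"
      unfolding val using T(2,3,5) contg cont
      by (intro continuous_intros) (auto intro: continuous_on_subset)
    then have "bounded ((\<lambda>x. F' x (axis i 1)) ` K)"
      using T(4) by (intro compact_imp_bounded compact_continuous_image)
    then obtain M where M: "\<And>x. x \<in> K \<Longrightarrow> \<bar>F' x (axis i 1)\<bar> \<le> M"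
      by (auto simp: bounded_iff)
    show ?thesis
    proof (rule integral_directional_derivative_eq_0[where K = K and M = "max M 0"])
      show "((\<lambda>x. g x * \<phi> x) has_derivative F' x) (at x)" for x
      proof (cases "x \<in> G")
        case True
        have "((\<lambda>x. g x * \<phi> x) has_derivative
            (\<lambda>v. g x * frechet_derivative \<phi> (at x) v + g' x v * \<phi> x)) (at x)"
          by (rule has_derivative_mult[OF der[OF True] T(1)])
        then show ?thesis
          using True by (simp add: F'_def[abs_def])
      next
        case False
        then have "x \<in> - K" using T(5) by auto
        have "((\<lambda>x. g x * \<phi> x) has_derivative (\<lambda>_. 0)) (at x)"
          by (rule has_derivative_transform_within_open[of "\<lambda>_. 0" _ _ _ "- K"])
            (use \<open>x \<in> - K\<close> T(4,6) in \<open>auto simp: compact_imp_closed open_Compl\<close>)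
        then show ?thesis
          using False by (simp add: F'_def[abs_def])
      qed
      show "\<bar>F' x (axis i 1)\<bar> \<le> max M 0" for x
        using M[of x] T(6,7)[of x] by (cases "x \<in> K") (auto simp: val)
    qed (use T(4,6) in auto)
  qed
  then have "(LINT x|lborel. g x * partial_deriv i \<phi> x) + (LINT x|lborel. g' x (axis i 1) * \<phi> x) = 0"
    using A(1) B(1) by (simp add: val)
  then show "(LINT x|lebesgue_on G. g x * partial_deriv i \<phi> x)
      = - (LINT x|lebesgue_on G. g' x (axis i 1) * \<phi> x)"
    using A(3) B(3) by simp
qed

lemma continuous_on_imp_Lp_loc:
  fixes f :: "real ^ 'n::finite \<Rightarrow> 'b::euclidean_space"
  assumes "open G" "continuous_on G f" "0 < p"
  shows "f \<in> Lp_loc p G"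
  unfolding Lp_loc_def
proof (intro CollectI conjI allI impI)
  show "f \<in> borel_measurable (lebesgue_on G)"
    using assms by (intro continuous_imp_measurable_on_sets_lebesgue) auto
  fix K assume K: "compact K \<and> K \<subseteq> G"
  have "continuous_on K (\<lambda>x. norm (f x) powr p)"
    using assms K by (intro continuous_on_powr' continuous_intros) (auto intro: continuous_on_subset)
  then have "integrable lborel (\<lambda>x. indicator K x *\<^sub>R (norm (f x) powr p))"
    using K by (intro borel_integrable_compact) auto
  then have "integrable lebesgue (\<lambda>x. indicator K x *\<^sub>R (norm (f x) powr p))"
    by (metis integrable_completion borel_measurable_integrable)
  then show "integrable (lebesgue_on K) (\<lambda>x. norm (f x) powr p)"
    using K by (subst integrable_restrict_space) (auto simp: compact_imp_closed borel_closed)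
qed


section \<open>The two groups of coordinates\<close>

lemma bounded_linear_fst_part: "bounded_linear (fst_part m :: real ^ 'n::{finite,linorder} \<Rightarrow> _)"
  unfolding linear_conv_bounded_linear[symmetric]
  by (rule linearI) (auto simp: fst_part_def vec_eq_iff)

lemma bounded_linear_snd_part: "bounded_linear (snd_part m :: real ^ 'n::{finite,linorder} \<Rightarrow> _)"
  unfolding linear_conv_bounded_linear[symmetric]
  by (rule linearI) (auto simp: snd_part_def vec_eq_iff)

lemmas fst_part_derivative = bounded_linear.has_derivative[OF bounded_linear_fst_part has_derivative_ident]
lemmas snd_part_derivative = bounded_linear.has_derivative[OF bounded_linear_snd_part has_derivative_ident]

lemma continuous_on_fst_part [continuous_intros]:
  "continuous_on S f \<Longrightarrow> continuous_on S (\<lambda>x. fst_part m (f x :: real ^ 'n::{finite,linorder}))"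
  by (rule bounded_linear.continuous_on[OF bounded_linear_fst_part])

lemma continuous_on_snd_part [continuous_intros]:
  "continuous_on S f \<Longrightarrow> continuous_on S (\<lambda>x. snd_part m (f x :: real ^ 'n::{finite,linorder}))"
  by (rule bounded_linear.continuous_on[OF bounded_linear_snd_part])

lemma inner_fst_part_fst_part: "fst_part m x \<bullet> fst_part m v = fst_part m x \<bullet> v"
  by (auto simp: inner_vec_def fst_part_def intro: sum.cong)

lemma inner_fst_part_left: "fst_part m x \<bullet> v = fst_part m v \<bullet> x"
  by (metis inner_fst_part_fst_part inner_commute)

lemma inner_snd_part_snd_part: "snd_part m x \<bullet> snd_part m v = snd_part m x \<bullet> v"
  by (auto simp: inner_vec_def snd_part_def intro: sum.cong)

lemma inner_snd_part_left: "snd_part m x \<bullet> v = snd_part m v \<bullet> x"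
  by (metis inner_snd_part_snd_part inner_commute)

lemma inner_fst_part_snd_part [simp]: "fst_part m x \<bullet> snd_part m v = 0"
  by (auto simp: inner_vec_def fst_part_def snd_part_def intro!: sum.neutral)

lemma norm_sum_fst_part_snd_part:
  "(norm (a *\<^sub>R fst_part m x + b *\<^sub>R snd_part m x))\<^sup>2
    = a * a * (norm (fst_part m x))\<^sup>2 + b * b * (norm (snd_part m x))\<^sup>2"
proof -
  have "snd_part m x \<bullet> fst_part m x = 0"
    by (simp add: inner_commute)
  then show ?thesis
    unfolding power2_norm_eq_inner by (simp add: inner_add_left inner_add_right)
qed

lemma coord_num_strict_mono: "i < j \<Longrightarrow> coord_num i < coord_num (j :: 'n::{finite,linorder})"
  unfolding coord_num_def
proof (rule psubset_card_mono)
  assume "i < j"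
  then have "j \<in> {k. k \<le> j} - {k. k \<le> i}" "{k. k \<le> i} \<subseteq> {k. k \<le> j}"
    by auto
  then show "{k. k \<le> i} \<subset> {k. k \<le> j}"
    by blast
qed simp

lemma bij_betw_coord_num: "bij_betw coord_num (UNIV :: 'n::{finite,linorder} set) {1..CARD('n)}"
proof -
  have inj: "inj (coord_num :: 'n \<Rightarrow> nat)"
    by (rule linorder_injI) (metis coord_num_strict_mono less_irrefl)
  have "coord_num (i :: 'n) \<in> {1..CARD('n)}" for i
  proof -
    have "card {i} \<le> coord_num i"
      unfolding coord_num_def by (rule card_mono) auto
    moreover have "coord_num i \<le> CARD('n)"
      unfolding coord_num_def by (rule card_mono) auto
    ultimately show ?thesis by simp
  qed
  then have "range (coord_num :: 'n \<Rightarrow> nat) \<subseteq> {1..CARD('n)}"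
    by blast
  then have "range (coord_num :: 'n \<Rightarrow> nat) = {1..CARD('n)}"
    by (rule card_subset_eq[rotated]) (simp_all add: card_image[OF inj])
  with inj show ?thesis
    by (simp add: bij_betw_def)
qed

text \<open>The coordinate numbers are \<open>1, \<dots>, n\<close>, each taken once. The two counts give the traces of
  \<open>x \<mapsto> x'\<close> and \<open>x \<mapsto> x''\<close>, through which the dimensions enter the divergence.\<close>

lemma card_first_coordinates:
  "card {i :: 'n::{finite,linorder}. coord_num i \<le> CARD('n) - m} = CARD('n) - m"
proof -
  let ?I = "{i :: 'n. coord_num i \<le> CARD('n) - m}"
  have "coord_num ` ?I = {1..CARD('n) - m}"
  proof
    show "coord_num ` ?I \<subseteq> {1..CARD('n) - m}"
      using bij_betw_apply[OF bij_betw_coord_num] by force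
    show "{1..CARD('n) - m} \<subseteq> coord_num ` ?I"
    proof
      fix j assume j: "j \<in> {1..CARD('n) - m}"
      then have "j \<in> coord_num ` (UNIV :: 'n set)"
        using bij_betw_imp_surj_on[OF bij_betw_coord_num] by auto
      with j show "j \<in> coord_num ` ?I" by auto
    qed
  qed
  moreover have "inj_on coord_num ?I"
    using bij_betw_coord_num[where 'n = 'n] by (auto simp: bij_betw_def intro: inj_on_subset)
  ultimately show ?thesis
    using card_image[of coord_num ?I] by simp
qed

lemma card_last_coordinates:
  assumes "m \<le> CARD('n::{finite,linorder})"
  shows "card {i :: 'n. CARD('n) - m < coord_num i} = m"
proof -
  have "{i :: 'n. CARD('n) - m < coord_num i} = - {i. coord_num i \<le> CARD('n) - m}"
    by auto
  then have "card {i :: 'n. CARD('n) - m < coord_num i} = CARD('n) - (CARD('n) - m)"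
    by (simp only: Compl_eq_Diff_UNIV card_Diff_subset[OF finite subset_UNIV] card_first_coordinates)
  with assms show ?thesis by simp
qed

lemma trace_fst_part: "(\<Sum>i\<in>UNIV. fst_part m (axis i 1) $ (i :: 'n::{finite,linorder})) = real (CARD('n) - m)"
proof -
  have "(\<Sum>i\<in>UNIV. fst_part m (axis i 1) $ (i :: 'n))
      = (\<Sum>i\<in>(UNIV :: 'n set). if coord_num i \<le> CARD('n) - m then 1 else 0)"
    by (rule sum.cong) (auto simp: fst_part_def axis_def)
  also have "\<dots> = real (card {i :: 'n. coord_num i \<le> CARD('n) - m})"
    by (simp flip: sum.inter_filter)
  finally show ?thesis by (simp add: card_first_coordinates)
qed

lemma trace_snd_part:
  assumes "m \<le> CARD('n::{finite,linorder})"
  shows "(\<Sum>i\<in>UNIV. snd_part m (axis i 1) $ (i :: 'n)) = real m"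
proof -
  have "(\<Sum>i\<in>UNIV. snd_part m (axis i 1) $ (i :: 'n))
      = (\<Sum>i\<in>(UNIV :: 'n set). if CARD('n) - m < coord_num i then 1 else 0)"
    by (rule sum.cong) (auto simp: snd_part_def axis_def)
  also have "\<dots> = real (card {i :: 'n. CARD('n) - m < coord_num i})"
    by (simp flip: sum.inter_filter)
  finally show ?thesis by (simp add: card_last_coordinates[OF assms])
qed

lemma open_dom_G: "open (dom_G m \<delta> :: (real ^ 'n::{finite,linorder}) set)"
  unfolding dom_G_def by (intro open_Collect_conj open_Collect_less continuous_intros)


section \<open>Biradial functions\<close>

text \<open>If \<open>c\<close> is a function of \<open>|x'|\<^sup>2\<close> and \<open>|x''|\<^sup>2\<close>, its gradient is \<open>c\<^sub>1 x' + c\<^sub>2 x''\<close>, where \<open>c\<^sub>1\<close> and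
  \<open>c\<^sub>2\<close> are twice the partial derivatives with respect to these two squares. Working with the pair
  \<open>(c\<^sub>1, c\<^sub>2)\<close> keeps all derivatives of \<open>u\<close> scalar.\<close>

definition biradial_C1 ::
  "nat \<Rightarrow> (real ^ 'n::{finite,linorder}) set \<Rightarrow>
    (real ^ 'n::{finite,linorder} \<Rightarrow> real) \<Rightarrow>
    (real ^ 'n::{finite,linorder} \<Rightarrow> real) \<Rightarrow>
    (real ^ 'n::{finite,linorder} \<Rightarrow> real) \<Rightarrow> bool"
  where
  "biradial_C1 m G c c\<^sub>1 c\<^sub>2 \<longleftrightarrow>
    (\<forall>x\<in>G. (c has_derivative (\<lambda>v. (c\<^sub>1 x *\<^sub>R fst_part m x + c\<^sub>2 x *\<^sub>R snd_part m x) \<bullet> v)) (at x)) \<and>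
    continuous_on G c\<^sub>1 \<and> continuous_on G c\<^sub>2"

lemma biradial_C1_derivative:
  "biradial_C1 m G c c\<^sub>1 c\<^sub>2 \<Longrightarrow> x \<in> G \<Longrightarrow>
    (c has_derivative (\<lambda>v. (c\<^sub>1 x *\<^sub>R fst_part m x + c\<^sub>2 x *\<^sub>R snd_part m x) \<bullet> v)) (at x)"
  by (simp add: biradial_C1_def)

lemma biradial_C1_continuous:
  assumes "biradial_C1 m G c c\<^sub>1 c\<^sub>2"
  shows "continuous_on G c" "continuous_on G c\<^sub>1" "continuous_on G c\<^sub>2"
proof -
  show "continuous_on G c"
    using has_derivative_at_withinI[OF biradial_C1_derivative[OF assms]]
    by (rule has_derivative_continuous_on)
qed (use assms in \<open>auto simp: biradial_C1_def\<close>)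

lemma biradial_C1_const: "biradial_C1 m G (\<lambda>_. k) (\<lambda>_. 0) (\<lambda>_. 0)"
  by (simp add: biradial_C1_def)

lemma biradial_C1_add:
  assumes "biradial_C1 m G c c\<^sub>1 c\<^sub>2" "biradial_C1 m G d d\<^sub>1 d\<^sub>2"
  shows "biradial_C1 m G (\<lambda>x. c x + d x) (\<lambda>x. c\<^sub>1 x + d\<^sub>1 x) (\<lambda>x. c\<^sub>2 x + d\<^sub>2 x)"
  using assms unfolding biradial_C1_def
  by (auto intro!: continuous_intros derivative_eq_intros simp: inner_add_left algebra_simps)

lemma biradial_C1_mult:
  assumes "biradial_C1 m G c c\<^sub>1 c\<^sub>2" "biradial_C1 m G d d\<^sub>1 d\<^sub>2"
  shows "biradial_C1 m G (\<lambda>x. c x * d x) (\<lambda>x. c\<^sub>1 x * d x + c x * d\<^sub>1 x) (\<lambda>x. c\<^sub>2 x * d x + c x * d\<^sub>2 x)"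
  using biradial_C1_continuous(1)[OF assms(1)] biradial_C1_continuous(1)[OF assms(2)] assms
  unfolding biradial_C1_def
  by (auto intro!: continuous_intros derivative_eq_intros simp: inner_add_left algebra_simps)

lemma biradial_C1_powr:
  assumes c: "biradial_C1 m G c c\<^sub>1 c\<^sub>2" and pos: "\<And>x. x \<in> G \<Longrightarrow> 0 < c x"
  shows "biradial_C1 m G (\<lambda>x. c x powr e) (\<lambda>x. e * c x powr (e - 1) * c\<^sub>1 x) (\<lambda>x. e * c x powr (e - 1) * c\<^sub>2 x)"
  unfolding biradial_C1_def
proof (intro conjI ballI)
  fix x assume x: "x \<in> G"
  have "((\<lambda>x. c x powr e) has_derivative
      (\<lambda>v. c x powr e * (0 * ln (c x) + (c\<^sub>1 x *\<^sub>R fst_part m x + c\<^sub>2 x *\<^sub>R snd_part m x) \<bullet> v * e / c x))) (at x)"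
    by (rule has_derivative_powr[OF biradial_C1_derivative[OF c x] has_derivative_const])
      (use pos x in auto)
  then show "((\<lambda>x. c x powr e) has_derivative (\<lambda>v. ((e * c x powr (e - 1) * c\<^sub>1 x) *\<^sub>R fst_part m x
      + (e * c x powr (e - 1) * c\<^sub>2 x) *\<^sub>R snd_part m x) \<bullet> v)) (at x)"
    by (rule has_derivative_eq_rhs)
      (use pos[OF x] in \<open>auto simp: fun_eq_iff powr_diff inner_add_left field_simps\<close>)
qed (use pos biradial_C1_continuous[OF c] in \<open>auto intro!: continuous_intros\<close>, (metis less_irrefl pos)+)

lemma biradial_C1_cong:
  assumes "biradial_C1 m G c c\<^sub>1 c\<^sub>2" "open G"
    and eq: "\<And>x. x \<in> G \<Longrightarrow> d x = c x" "\<And>x. x \<in> G \<Longrightarrow> d\<^sub>1 x = c\<^sub>1 x" "\<And>x. x \<in> G \<Longrightarrow> d\<^sub>2 x = c\<^sub>2 x"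
  shows "biradial_C1 m G d d\<^sub>1 d\<^sub>2"
  unfolding biradial_C1_def
proof (intro conjI ballI)
  fix x assume x: "x \<in> G"
  have "(d has_derivative (\<lambda>v. (c\<^sub>1 x *\<^sub>R fst_part m x + c\<^sub>2 x *\<^sub>R snd_part m x) \<bullet> v)) (at x)"
    by (rule has_derivative_transform_within_open[OF biradial_C1_derivative[OF assms(1) x] assms(2) x])
      (simp add: eq)
  then show "(d has_derivative (\<lambda>v. (d\<^sub>1 x *\<^sub>R fst_part m x + d\<^sub>2 x *\<^sub>R snd_part m x) \<bullet> v)) (at x)"
    using x by (simp add: eq)
next
  show "continuous_on G d\<^sub>1" "continuous_on G d\<^sub>2"
    using biradial_C1_continuous(2,3)[OF assms(1)] eq(2,3) by (auto cong: continuous_on_cong)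
qed

lemma biradial_C1_fst_norm_sq:
  fixes G :: "(real ^ 'n::{finite,linorder}) set"
  shows "biradial_C1 m G (\<lambda>x. (norm (fst_part m x))\<^sup>2) (\<lambda>_. 2) (\<lambda>_. 0)"
proof -
  have "((\<lambda>x. fst_part m x \<bullet> fst_part m x) has_derivative (\<lambda>v. (2 *\<^sub>R fst_part m x) \<bullet> v)) (at x)"
    if "x \<in> G" for x
    by (rule has_derivative_eq_rhs[OF has_derivative_inner[OF fst_part_derivative fst_part_derivative]])
      (auto simp: fun_eq_iff inner_fst_part_fst_part intro: inner_fst_part_left)
  then show ?thesis
    by (simp add: biradial_C1_def power2_norm_eq_inner)
qed

lemma biradial_C1_snd_norm_sq:
  fixes G :: "(real ^ 'n::{finite,linorder}) set"
  shows "biradial_C1 m G (\<lambda>x. (norm (snd_part m x))\<^sup>2) (\<lambda>_. 0) (\<lambda>_. 2)"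
proof -
  have "((\<lambda>x. snd_part m x \<bullet> snd_part m x) has_derivative (\<lambda>v. (2 *\<^sub>R snd_part m x) \<bullet> v)) (at x)"
    if "x \<in> G" for x
    by (rule has_derivative_eq_rhs[OF has_derivative_inner[OF snd_part_derivative snd_part_derivative]])
      (auto simp: fun_eq_iff inner_snd_part_snd_part intro: inner_snd_part_left)
  then show ?thesis
    by (simp add: biradial_C1_def power2_norm_eq_inner)
qed

lemma biradial_C1_fst_norm_powr:
  assumes G: "open G" and nz: "\<And>x. x \<in> G \<Longrightarrow> 0 < norm (fst_part m x)"
  shows "biradial_C1 m G (\<lambda>x. norm (fst_part m x) powr e) (\<lambda>x. e * norm (fst_part m x) powr (e - 2)) (\<lambda>_. 0)"
proof -
  have half: "((norm (fst_part m x))\<^sup>2) powr (d / 2) = norm (fst_part m x) powr d" if "x \<in> G" for x d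
    using nz[OF that] by (simp add: powr_powr flip: powr_numeral)
  have "e / 2 - 1 = (e - 2) / 2"
    by simp
  then have "biradial_C1 m G (\<lambda>x. ((norm (fst_part m x))\<^sup>2) powr (e / 2))
      (\<lambda>x. e / 2 * ((norm (fst_part m x))\<^sup>2) powr ((e - 2) / 2) * 2)
      (\<lambda>x. e / 2 * ((norm (fst_part m x))\<^sup>2) powr ((e - 2) / 2) * 0)"
    using biradial_C1_powr[OF biradial_C1_fst_norm_sq, of G m "e / 2"] nz
    by (simp only: zero_less_power)
  then show ?thesis
    by (rule biradial_C1_cong[OF _ G]) (use half in auto)
qed

text \<open>The trace of \<open>x \<mapsto> x'\<close> is \<open>n - m\<close> and that of \<open>x \<mapsto> x''\<close> is \<open>m\<close>; the rest of the divergence is the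
  derivative of the coefficients along \<open>x'\<close> and \<open>x''\<close>.\<close>

lemma integration_by_parts_biradial_field:
  fixes P Q :: "real ^ 'n::{finite,linorder} \<Rightarrow> real"
  assumes G: "open G" and m: "m \<le> CARD('n)" and \<theta>: "\<theta> \<in> test_functions G"
    and P: "biradial_C1 m G P P\<^sub>1 P\<^sub>2" and Q: "biradial_C1 m G Q Q\<^sub>1 Q\<^sub>2"
  shows "(LINT x|lebesgue_on G. (P x *\<^sub>R fst_part m x + Q x *\<^sub>R snd_part m x) \<bullet> grad \<theta> x)
    = - (LINT x|lebesgue_on G. (P\<^sub>1 x * (norm (fst_part m x))\<^sup>2 + real (CARD('n) - m) * P x
          + Q\<^sub>2 x * (norm (snd_part m x))\<^sup>2 + real m * Q x) * \<theta> x)"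
proof -
  define V where "V i x = P x * fst_part m x $ i + Q x * snd_part m x $ i" for i x
  define V' where "V' i x v =
      ((P\<^sub>1 x *\<^sub>R fst_part m x + P\<^sub>2 x *\<^sub>R snd_part m x) \<bullet> v) * fst_part m x $ i + P x * fst_part m v $ i
    + (((Q\<^sub>1 x *\<^sub>R fst_part m x + Q\<^sub>2 x *\<^sub>R snd_part m x) \<bullet> v) * snd_part m x $ i + Q x * snd_part m v $ i)"
    for i x v
  have der: "(V i has_derivative V' i x) (at x)" if x: "x \<in> G" for i x
    unfolding V_def[abs_def] V'_def[abs_def]
    by (rule has_derivative_eq_rhs,
        rule has_derivative_add[OF has_derivative_mult[OF biradial_C1_derivative[OF P x]
            bounded_linear.has_derivative[OF bounded_linear_vec_nth fst_part_derivative]]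
          has_derivative_mult[OF biradial_C1_derivative[OF Q x]
            bounded_linear.has_derivative[OF bounded_linear_vec_nth snd_part_derivative]]])
      (simp add: fun_eq_iff algebra_simps)
  have cont: "continuous_on G (\<lambda>x. V' i x (axis i 1))" for i
    unfolding V'_def using biradial_C1_continuous[OF P] biradial_C1_continuous[OF Q]
    by (intro continuous_intros)
  note ibp = integration_by_parts_test_function[OF G \<theta> der cont]
  have div: "(\<Sum>i\<in>UNIV. V' i x (axis i 1)) = P\<^sub>1 x * (norm (fst_part m x))\<^sup>2 + real (CARD('n) - m) * P x
          + Q\<^sub>2 x * (norm (snd_part m x))\<^sup>2 + real m * Q x" for x
  proof -
    have eq: "V' i x (axis i 1) = P\<^sub>1 x * (fst_part m x $ i * fst_part m x $ i) + P x * fst_part m (axis i 1) $ i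
        + (Q\<^sub>2 x * (snd_part m x $ i * snd_part m x $ i) + Q x * snd_part m (axis i 1) $ i)" for i
    proof -
      have "fst_part m x $ i = 0 \<or> snd_part m x $ i = 0"
        by (simp add: fst_part_def snd_part_def)
      then show ?thesis
        by (auto simp: V'_def inner_axis algebra_simps)
    qed
    show ?thesis
      unfolding eq sum.distrib
      by (simp add: trace_fst_part trace_snd_part[OF m] power2_norm_eq_inner inner_vec_def
          flip: sum_distrib_left)
  qed
  have "(LINT x|lebesgue_on G. (P x *\<^sub>R fst_part m x + Q x *\<^sub>R snd_part m x) \<bullet> grad \<theta> x)
      = (LINT x|lebesgue_on G. (\<Sum>i\<in>UNIV. V i x * partial_deriv i \<theta> x))"
    by (simp add: inner_vec_def grad_def V_def)
  also have "\<dots> = (\<Sum>i\<in>UNIV. LINT x|lebesgue_on G. V i x * partial_deriv i \<theta> x)"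
    using ibp(1) by (rule Bochner_Integration.integral_sum)
  also have "\<dots> = - (\<Sum>i\<in>UNIV. LINT x|lebesgue_on G. V' i x (axis i 1) * \<theta> x)"
    by (simp add: ibp(3) sum_negf)
  also have "(\<Sum>i\<in>UNIV. LINT x|lebesgue_on G. V' i x (axis i 1) * \<theta> x)
      = (LINT x|lebesgue_on G. (\<Sum>i\<in>UNIV. V' i x (axis i 1) * \<theta> x))"
    using ibp(2) by (rule Bochner_Integration.integral_sum[symmetric])
  finally show ?thesis
    by (simp flip: sum_distrib_right add: div)
qed


section \<open>The \<open>p\<close>-Laplacian of a biradial function\<close>

text \<open>This is \<open>|\<nabla>u|\<^sup>4\<^sup>-\<^sup>p\<close> times the \<open>p\<close>-Laplacian, that is, \<open>|\<nabla>u|\<^sup>2 \<Delta>u + (p - 2) \<langle>D\<^sup>2u \<nabla>u, \<nabla>u\<rangle>\<close>, for a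
  biradial \<open>u\<close> on \<open>\<real>\<^sup>k \<times> \<real>\<^sup>m\<close> with \<open>\<nabla>u = a x' + b x''\<close>, \<open>\<nabla>a = f x' + g x''\<close>, \<open>\<nabla>b = g x' + h x''\<close>,
  \<open>\<rho> = |x'|\<^sup>2\<close> and \<open>\<sigma> = |x''|\<^sup>2\<close>.\<close>

definition p_laplace_form ::
  "real \<Rightarrow> real \<Rightarrow> real \<Rightarrow> real \<Rightarrow> real \<Rightarrow> real \<Rightarrow> real \<Rightarrow> real \<Rightarrow> real \<Rightarrow> real \<Rightarrow> real" where
  "p_laplace_form p k m \<rho> \<sigma> a b f g h =
     a\<^sup>2 * \<rho> * ((p - 1) * (f * \<rho>) + (p - 2 + k) * a + h * \<sigma> + m * b)
   + b\<^sup>2 * \<sigma> * (f * \<rho> + k * a + (p - 1) * (h * \<sigma>) + (p - 2 + m) * b)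
   + 2 * (p - 2) * a * b * (g * \<rho>) * \<sigma>"

text \<open>The flux is \<open>W a x' + W b x''\<close> with the biradial weight \<open>W = |\<nabla>u|\<^sup>p\<^sup>-\<^sup>2 = N\<^sup>(\<^sup>p\<^sup>-\<^sup>2\<^sup>)\<^sup>/\<^sup>2\<close>, so its divergence is
  computed by the rules above. Every term contains \<open>N\<^sup>(\<^sup>p\<^sup>-\<^sup>4\<^sup>)\<^sup>/\<^sup>2\<close>, and what remains is
  \<open>p_laplace_form\<close>.\<close>

lemma weak_p_laplacian_biradial:
  fixes a b :: "real ^ 'n::{finite,linorder} \<Rightarrow> real" and m :: nat
  defines "N \<equiv> \<lambda>x. a x * a x * (norm (fst_part m x))\<^sup>2 + b x * b x * (norm (snd_part m x))\<^sup>2"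
    and "Du \<equiv> \<lambda>x. a x *\<^sub>R fst_part m x + b x *\<^sub>R snd_part m x"
  assumes G: "open G" and m: "m \<le> CARD('n)" and \<theta>: "\<theta> \<in> test_functions G"
    and a: "biradial_C1 m G a f g" and b: "biradial_C1 m G b g h"
    and pos: "\<And>x. x \<in> G \<Longrightarrow> 0 < N x"
  shows "(LINT x|lebesgue_on G. norm (Du x) powr (p - 2) * (Du x \<bullet> grad \<theta> x))
    = - (LINT x|lebesgue_on G. N x powr ((p - 4) / 2) * p_laplace_form p (real (CARD('n) - m)) (real m)
          ((norm (fst_part m x))\<^sup>2) ((norm (snd_part m x))\<^sup>2) (a x) (b x) (f x) (g x) (h x) * \<theta> x)"
    (is "?L = - (LINT x|lebesgue_on G. ?E x * \<theta> x)")
proof -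
  define e where "e = (p - 2) / 2"
  have e1: "e - 1 = (p - 4) / 2" and "2 * e = p - 2"
    by (simp_all add: e_def field_simps)
  define W where "W x = N x powr e" for x
  have sp: "space (lebesgue_on G) = G"
    by simp
  note N = biradial_C1_add[OF biradial_C1_mult[OF biradial_C1_mult[OF a a] biradial_C1_fst_norm_sq]
      biradial_C1_mult[OF biradial_C1_mult[OF b b] biradial_C1_snd_norm_sq], folded N_def]
  note W = biradial_C1_powr[OF N pos, of e, folded W_def]
  note ibp = integration_by_parts_biradial_field[OF G m \<theta> biradial_C1_mult[OF W a] biradial_C1_mult[OF W b]]
  have "?L = (LINT x|lebesgue_on G.
      ((W x * a x) *\<^sub>R fst_part m x + (W x * b x) *\<^sub>R snd_part m x) \<bullet> grad \<theta> x)"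
  proof (rule Bochner_Integration.integral_cong[OF refl])
    fix x assume "x \<in> space (lebesgue_on G)"
    then have x: "0 < N x"
      using pos sp by simp
    have "N x = (norm (Du x))\<^sup>2"
      by (simp add: N_def Du_def norm_sum_fst_part_snd_part)
    then have "W x = norm (Du x) powr (p - 2)"
      using x \<open>2 * e = p - 2\<close> by (simp add: W_def powr_powr flip: powr_numeral)
    then show "norm (Du x) powr (p - 2) * (Du x \<bullet> grad \<theta> x)
      = ((W x * a x) *\<^sub>R fst_part m x + (W x * b x) *\<^sub>R snd_part m x) \<bullet> grad \<theta> x"
      by (simp add: Du_def inner_add_left algebra_simps)
  qed
  also note ibp
  also have "(LINT x|lebesgue_on G.
      (((e * N x powr (e - 1) * ((f x * a x + a x * f x) * (norm (fst_part m x))\<^sup>2 + a x * a x * 2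
            + ((g x * b x + b x * g x) * (norm (snd_part m x))\<^sup>2 + b x * b x * 0))) * a x + W x * f x)
          * (norm (fst_part m x))\<^sup>2
        + real (CARD('n) - m) * (W x * a x)
        + ((e * N x powr (e - 1) * ((g x * a x + a x * g x) * (norm (fst_part m x))\<^sup>2 + a x * a x * 0
            + ((h x * b x + b x * h x) * (norm (snd_part m x))\<^sup>2 + b x * b x * 2))) * b x + W x * h x)
          * (norm (snd_part m x))\<^sup>2
        + real m * (W x * b x)) * \<theta> x) = (LINT x|lebesgue_on G. ?E x * \<theta> x)"
  proof (rule Bochner_Integration.integral_cong[OF refl])
    fix x assume "x \<in> space (lebesgue_on G)"
    then have x: "0 < N x"
      using pos sp by simp
    define w where "w = N x powr (e - 1)"
    have "W x = w * N x"
      using x by (simp add: W_def w_def powr_diff)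
    note Wx = this[unfolded N_def]
    have e: "e = (p - 2) / 2" by (rule e_def)
    show "(((e * N x powr (e - 1) * ((f x * a x + a x * f x) * (norm (fst_part m x))\<^sup>2 + a x * a x * 2
            + ((g x * b x + b x * g x) * (norm (snd_part m x))\<^sup>2 + b x * b x * 0))) * a x + W x * f x)
          * (norm (fst_part m x))\<^sup>2
        + real (CARD('n) - m) * (W x * a x)
        + ((e * N x powr (e - 1) * ((g x * a x + a x * g x) * (norm (fst_part m x))\<^sup>2 + a x * a x * 0
            + ((h x * b x + b x * h x) * (norm (snd_part m x))\<^sup>2 + b x * b x * 2))) * b x + W x * h x)
          * (norm (snd_part m x))\<^sup>2
        + real m * (W x * b x)) * \<theta> x = ?E x * \<theta> x"
      unfolding e1[symmetric] w_def[symmetric] Wx p_laplace_form_def unfolding e by algebra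
  qed
  finally show ?thesis .
qed

lemma W1p_loc_biradial:
  fixes u :: "real ^ 'n::{finite,linorder} \<Rightarrow> real"
  assumes G: "open G" and p: "0 < p" and u: "biradial_C1 m G u a b"
    and ab: "continuous_on G a" "continuous_on G b"
  shows "W1p_loc_with_gradient p G u (\<lambda>x. a x *\<^sub>R fst_part m x + b x *\<^sub>R snd_part m x)"
  unfolding W1p_loc_with_gradient_def weak_gradient_def
proof (intro conjI ballI allI)
  show "u \<in> Lp_loc p G"
    by (rule continuous_on_imp_Lp_loc[OF G biradial_C1_continuous(1)[OF u] p])
  show "(\<lambda>x. a x *\<^sub>R fst_part m x + b x *\<^sub>R snd_part m x) \<in> Lp_loc p G"
    using ab by (intro continuous_on_imp_Lp_loc[OF G _ p] continuous_intros)
  fix \<phi> i assume "\<phi> \<in> test_functions G"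
  have "continuous_on G (\<lambda>x. (a x *\<^sub>R fst_part m x + b x *\<^sub>R snd_part m x) \<bullet> axis i 1)"
    using ab by (intro continuous_intros)
  from integration_by_parts_test_function(3)[OF G \<open>\<phi> \<in> test_functions G\<close> biradial_C1_derivative[OF u] this]
  show "(LINT x|lebesgue_on G. u x * partial_deriv i \<phi> x)
      = - (LINT x|lebesgue_on G. (a x *\<^sub>R fst_part m x + b x *\<^sub>R snd_part m x) $ i * \<phi> x)"
    by (simp add: inner_axis)
qed

text \<open>As \<open>a x' \<noteq> 0\<close> keeps the gradient away from zero, the weight \<open>|\<nabla>u|\<^sup>p\<^sup>-\<^sup>2\<close> is differentiable, and the weak
  inequality reduces to a pointwise sign.\<close>

lemma biradial_p_subsolution_p_supersolution:
  fixes u a b :: "real ^ 'n::{finite,linorder} \<Rightarrow> real"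
  assumes G: "open G" and m: "m \<le> CARD('n)" and p: "0 < p"
    and u: "biradial_C1 m G u a b" and a: "biradial_C1 m G a f g" and b: "biradial_C1 m G b g h"
    and pos: "\<And>x. x \<in> G \<Longrightarrow> 0 < norm (fst_part m x) \<and> a x \<noteq> 0"
  defines "E \<equiv> \<lambda>x. p_laplace_form p (real (CARD('n) - m)) (real m)
          ((norm (fst_part m x))\<^sup>2) ((norm (snd_part m x))\<^sup>2) (a x) (b x) (f x) (g x) (h x)"
  shows "(\<And>x. x \<in> G \<Longrightarrow> 0 \<le> E x) \<Longrightarrow> p_subsolution p G u"
    and "(\<And>x. x \<in> G \<Longrightarrow> E x \<le> 0) \<Longrightarrow> p_supersolution p G u"
proof -
  define Du where "Du x = a x *\<^sub>R fst_part m x + b x *\<^sub>R snd_part m x" for x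
  define N where "N x = a x * a x * (norm (fst_part m x))\<^sup>2 + b x * b x * (norm (snd_part m x))\<^sup>2" for x
  have "0 < N x" if "x \<in> G" for x
  proof -
    have "0 < (a x * norm (fst_part m x))\<^sup>2"
      using pos[OF that] by (simp only: zero_less_power2 mult_eq_0_iff) simp
    then have "0 < a x * a x * (norm (fst_part m x))\<^sup>2"
      by (simp only: power2_eq_square ac_simps)
    then show ?thesis
      unfolding N_def by (rule add_pos_nonneg) simp
  qed
  note weak = weak_p_laplacian_biradial[OF G m _ a b this[unfolded N_def], of _ p,
      folded N_def Du_def]
  have W: "W1p_loc_with_gradient p G u Du"
    unfolding Du_def[abs_def] using W1p_loc_biradial[OF G p u] biradial_C1_continuous(1) a b by blast
  show "p_subsolution p G u" if E: "\<And>x. x \<in> G \<Longrightarrow> 0 \<le> E x"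
    unfolding p_subsolution_def
  proof (intro exI conjI ballI impI)
    fix \<theta> :: "real ^ 'n::{finite,linorder} \<Rightarrow> real" assume \<theta>: "\<theta> \<in> test_functions G" "\<forall>x. 0 \<le> \<theta> x"
    have "0 \<le> (LINT x|lebesgue_on G. N x powr ((p - 4) / 2) * E x * \<theta> x)"
      using E \<theta> by (intro Bochner_Integration.integral_nonneg) auto
    then show "(LINT x|lebesgue_on G. norm (Du x) powr (p - 2) * (Du x \<bullet> grad \<theta> x)) \<le> 0"
      by (simp only: weak[OF \<theta>(1)] E_def neg_le_0_iff_le)
  qed (rule W)
  show "p_supersolution p G u" if E: "\<And>x. x \<in> G \<Longrightarrow> E x \<le> 0"
    unfolding p_supersolution_def
  proof (intro exI conjI ballI impI)
    fix \<theta> :: "real ^ 'n::{finite,linorder} \<Rightarrow> real" assume \<theta>: "\<theta> \<in> test_functions G" "\<forall>x. 0 \<le> \<theta> x"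
    have "0 \<le> (LINT x|lebesgue_on G. - (N x powr ((p - 4) / 2) * E x * \<theta> x))"
      using E \<theta> by (intro Bochner_Integration.integral_nonneg)
        (auto simp: mult_nonneg_nonpos mult_nonpos_nonneg)
    then show "0 \<le> (LINT x|lebesgue_on G. norm (Du x) powr (p - 2) * (Du x \<bullet> grad \<theta> x))"
      by (simp only: weak[OF \<theta>(1)] E_def Bochner_Integration.integral_minus)
  qed (rule W)
qed


section \<open>The sign of the \<open>p\<close>-Laplacian for the two barriers\<close>

text \<open>Put \<open>y = r\<^sup>\<beta>\<^sup>-\<^sup>2\<close>, \<open>z = r\<^sup>\<gamma>\<^sup>-\<^sup>2\<close>, \<open>q = r\<^sup>\<gamma>\<close>. The factor of \<open>a\<^sup>2 \<rho>\<close> is at most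
  \<open>-(p - 1)(\<beta> - \<gamma>) \<gamma> \<sigma> z\<close>, because the constant \<open>-(p - 2 + k)\<close> coming from \<open>-r\<^sup>2/2\<close> absorbs the second derivatives
  in \<open>x''\<close>. All other terms contain \<open>\<sigma> q\<close> as well, so after division by it the claim is that
  \<open>a\<^sup>2 (p - 1)(\<beta> - \<gamma>) \<gamma>\<close> dominates a quantity of at most linear growth in \<open>a\<close>. It does since \<open>a\<close> is of order at
  least \<open>1/r\<close>. Both sides carry a factor \<open>p - 1\<close>, so the smallness conditions on \<open>r\<close> see \<open>p\<close> only through
  \<open>\<beta> - \<gamma>\<close>.\<close>

lemma p_laplace_form_u_hat_nonpos:
  fixes p k m n \<gamma> \<beta> r \<sigma> :: real
  defines "\<beta> \<equiv> (p - k) / (p - 1)"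
  defines "a \<equiv> \<beta> * r powr (\<beta> - 2) + \<gamma> * \<sigma> * r powr (\<gamma> - 2) - 1"
    and "f \<equiv> \<beta> * (\<beta> - 2) * r powr (\<beta> - 4) + \<gamma> * (\<gamma> - 2) * \<sigma> * r powr (\<gamma> - 4)"
  assumes r: "0 < r" "r \<le> 1" and \<sigma>: "0 \<le> \<sigma>" and k: "2 \<le> k" "k < p" and m: "1 \<le> m" "m \<le> n"
    and \<gamma>: "0 < \<gamma>" "\<gamma> < \<beta>"
    and small: "r \<le> \<gamma> / 2" "n * r powr \<gamma> \<le> 1" "(40 + 16 * n) * r \<le> \<gamma>\<^sup>2 * (\<beta> - \<gamma>)"
  shows "0 < a"
    and "p_laplace_form p k m (r\<^sup>2) \<sigma> a (2 * r powr \<gamma>) f (2 * \<gamma> * r powr (\<gamma> - 2)) 0 \<le> 0"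
proof -
  define y where "y = r powr (\<beta> - 2)"
  define z where "z = r powr (\<gamma> - 2)"
  define q where "q = r powr \<gamma>"
  have \<beta>: "\<beta> < 1" "(p - 1) * \<beta> = p - k"
    using k by (auto simp: \<beta>_def field_simps)
  have z: "z * r\<^sup>2 = q" "r powr (\<gamma> - 4) * r\<^sup>2 = z" and y: "r powr (\<beta> - 4) * r\<^sup>2 = y"
    using r unfolding y_def z_def q_def by (simp_all flip: powr_numeral powr_add)
  have pos: "0 < y" "0 < z" "0 < q"
    using r by (simp_all add: y_def z_def q_def)
  have q1: "q \<le> 1"
    using r \<gamma> powr_mono2[of \<gamma> r 1] by (simp add: q_def)
  have fr: "f * r\<^sup>2 = \<beta> * (\<beta> - 2) * y + \<gamma> * (\<gamma> - 2) * \<sigma> * z"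
    unfolding f_def distrib_right mult.assoc z y ..
  have ae: "a = \<beta> * y + \<gamma> * \<sigma> * z - 1"
    by (simp add: a_def y_def z_def)
  (* a r is the radial derivative of u, which is at least \<beta> r^(\<beta> - 1) - r. *)
  have ar: "\<gamma> / 2 \<le> a * r"
  proof -
    have "r powr (-1) \<le> y"
      unfolding y_def using r \<beta> \<gamma> by (intro powr_mono') auto
    then have "1 \<le> y * r"
      using r by (simp add: powr_minus field_simps)
    then have "\<gamma> * 1 \<le> \<beta> * (y * r)"
      using \<gamma> by (intro mult_mono) auto
    moreover have "0 \<le> \<gamma> * \<sigma> * z * r"
      using \<gamma> \<sigma> pos r by simp
    ultimately show ?thesis
      using small(1) by (simp add: ae algebra_simps)
  qed
  have a1: "1 \<le> a"
  proof -
    have "1 * r \<le> a * r"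
      using ar small(1) by linarith
    then show ?thesis
      using r by (simp only: mult_le_cancel_right_pos)
  qed
  then show "0 < a" by simp
  have big: "20 + 8 * n \<le> a * ((\<beta> - \<gamma>) * \<gamma>)"
  proof -
    have "(20 + 8 * n) * r \<le> (\<gamma> / 2) * ((\<beta> - \<gamma>) * \<gamma>)"
      using small(3) by (simp add: power2_eq_square algebra_simps)
    also have "\<dots> \<le> (a * r) * ((\<beta> - \<gamma>) * \<gamma>)"
      using ar \<gamma> by (intro mult_right_mono) auto
    finally have "(20 + 8 * n) * r \<le> (a * ((\<beta> - \<gamma>) * \<gamma>)) * r"
      by (simp only: ac_simps)
    then show ?thesis
      using r by (simp only: mult_le_cancel_right_pos)
  qed
  (* r^\<beta> is p-harmonic in the first k variables: (p - 1) \<beta> = p - k cancels the coefficient of y. *)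
  have X1: "(p - 1) * (f * r\<^sup>2) + (p - 2 + k) * a + 0 * \<sigma> + m * (2 * q) \<le> - ((p - 1) * (\<beta> - \<gamma>) * \<gamma> * \<sigma> * z)"
  proof -
    have "(p - 1) * (f * r\<^sup>2) + (p - 2 + k) * a
        = \<beta> * y * ((p - 1) * \<beta> - (p - k)) + \<gamma> * \<sigma> * z * ((p - 1) * \<gamma> - (p - k)) - (p - 2 + k)"
      unfolding fr ae by algebra
    also have "\<dots> = - ((p - 1) * (\<beta> - \<gamma>) * \<gamma> * \<sigma> * z) - (p - 2 + k)"
      unfolding \<beta>(2)[symmetric] by algebra
    finally have "(p - 1) * (f * r\<^sup>2) + (p - 2 + k) * a = \<dots>" .
    moreover have "m * q \<le> 1"
      using m pos small(2) mult_right_mono[of m n q] unfolding q_def by linarith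
    ultimately show ?thesis
      using k by linarith
  qed
  have X2: "f * r\<^sup>2 + k * a + (p - 1) * (0 * \<sigma>) + (p - 2 + m) * (2 * q) \<le> (k - 1) * a + (p - 2 + m) * (2 * q)"
  proof -
    have "f * r\<^sup>2 + a = - (\<beta> * y * (1 - \<beta>)) - (\<gamma> * \<sigma> * z * (1 - \<gamma>)) - 1"
      unfolding fr ae by algebra
    moreover have "0 \<le> \<beta> * y * (1 - \<beta>)" "0 \<le> \<gamma> * \<sigma> * z * (1 - \<gamma>)"
      using \<beta> \<gamma> \<sigma> pos by simp_all
    ultimately show ?thesis by (simp add: algebra_simps)
  qed
  have bracket: "4 * q * ((k - 1) * a + (p - 2 + m) * (2 * q)) + 8 * (p - 2) * \<gamma> * a * q
      \<le> a * (a * ((p - 1) * (\<beta> - \<gamma>) * \<gamma>))"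
  proof -
    have "(k - 1) * a + (p - 2 + m) * (2 * q) \<le> (p - 1) * a + ((p - 1) * (1 + n)) * (2 * a)"
    proof (intro add_mono mult_mono)
      have "1 * n \<le> (p - 1) * n"
        using k m by (intro mult_right_mono) auto
      then have "m \<le> (p - 1) * n"
        using m(2) by (simp only: mult_1)
      then show "p - 2 + m \<le> (p - 1) * (1 + n)"
        by (simp add: algebra_simps)
    qed (use k m a1 q1 pos in auto)
    then have "q * ((k - 1) * a + (p - 2 + m) * (2 * q)) \<le> 1 * ((p - 1) * a + ((p - 1) * (1 + n)) * (2 * a))"
      using q1 pos k m a1 by (intro mult_mono) auto
    moreover have "(p - 2) * (\<gamma> * a * q) \<le> (p - 1) * (1 * a * 1)"
      using k a1 q1 pos \<gamma> \<beta> by (intro mult_mono) auto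
    moreover have "(p - 1) * a * (20 + 8 * n) \<le> (p - 1) * a * (a * ((\<beta> - \<gamma>) * \<gamma>))"
      using big k a1 by (intro mult_left_mono) auto
    ultimately show ?thesis
      by (simp add: algebra_simps)
  qed
  have "p_laplace_form p k m (r\<^sup>2) \<sigma> a (2 * q) f (2 * \<gamma> * z) 0
      \<le> a\<^sup>2 * r\<^sup>2 * (- ((p - 1) * (\<beta> - \<gamma>) * \<gamma> * \<sigma> * z))
        + (2 * q)\<^sup>2 * \<sigma> * ((k - 1) * a + (p - 2 + m) * (2 * q))
        + 2 * (p - 2) * a * (2 * q) * (2 * \<gamma> * z * r\<^sup>2) * \<sigma>"
    unfolding p_laplace_form_def using X1 X2 \<sigma>
    by (intro add_mono mult_left_mono order.refl) auto
  also have "\<dots> = \<sigma> * q * (4 * q * ((k - 1) * a + (p - 2 + m) * (2 * q)) + 8 * (p - 2) * \<gamma> * a * q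
      - a * (a * ((p - 1) * (\<beta> - \<gamma>) * \<gamma>)))"
    unfolding z(1)[symmetric] by algebra
  also have "\<dots> \<le> 0"
    using bracket \<sigma> pos by (intro mult_nonneg_nonpos) auto
  finally show "p_laplace_form p k m (r\<^sup>2) \<sigma> a (2 * r powr \<gamma>) f (2 * \<gamma> * r powr (\<gamma> - 2)) 0 \<le> 0"
    by (simp only: q_def z_def)
qed

text \<open>Here \<open>r\<^sup>\<beta>\<close> drops out of the factor of \<open>a\<^sup>2 \<rho>\<close> again and the summand \<open>r\<close> leaves \<open>(k - 1)/r\<close>, which
  beats the second derivatives in \<open>x''\<close>, of size \<open>2 m r\<^sup>\<beta>\<close>, in this factor and in that of \<open>b\<^sup>2 \<sigma>\<close>. The negative part of the
  latter that grows with \<open>p\<close> is compensated by the mixed term, as \<open>a \<beta> \<ge> \<beta>/r \<ge> 1 \<ge> r\<^sup>\<beta>\<close>.\<close>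

lemma p_laplace_form_u_check_nonneg:
  fixes p k m n \<gamma> \<beta> r \<sigma> :: real
  defines "\<beta> \<equiv> (p - k) / (p - 1)"
  defines "a \<equiv> (1 - \<sigma>) * (\<beta> * r powr (\<beta> - 2)) + r powr (-1)"
    and "f \<equiv> (1 - \<sigma>) * (\<beta> * (\<beta> - 2) * r powr (\<beta> - 4)) - r powr (-3)"
  assumes r: "0 < r" "r \<le> 1" and \<sigma>: "0 \<le> \<sigma>" "\<sigma> \<le> 1" and k: "2 \<le> k" "k < p" and m: "1 \<le> m" "m \<le> n"
    and \<beta>: "0 < \<beta>" and small: "r \<le> \<beta>" "2 * n * r \<le> 1"
  shows "0 < a"
    and "0 \<le> p_laplace_form p k m (r\<^sup>2) \<sigma> a (- (2 * r powr \<beta>)) f (- (2 * \<beta> * r powr (\<beta> - 2))) 0"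
proof -
  define y where "y = r powr (\<beta> - 2)"
  define z where "z = r powr (-1)"
  define q where "q = r powr \<beta>"
  have \<beta>eq: "(p - 1) * \<beta> = p - k"
    using k by (auto simp: \<beta>_def field_simps)
  have y: "y * r\<^sup>2 = q" "r powr (\<beta> - 4) * r\<^sup>2 = y" and z: "r powr (-3) * r\<^sup>2 = z"
    using r unfolding y_def z_def q_def by (simp_all flip: powr_numeral powr_add)
  have zr: "z * r = 1"
    using r by (simp add: z_def powr_minus)
  have pos: "0 < y" "0 < z" "0 < q"
    using r by (simp_all add: y_def z_def q_def)
  have q1: "q \<le> 1"
    using r \<beta> powr_mono2[of \<beta> r 1] by (simp add: q_def)
  have fr: "f * r\<^sup>2 = (1 - \<sigma>) * (\<beta> * (\<beta> - 2) * y) - z"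
    unfolding f_def left_diff_distrib mult.assoc z y ..
  have ae: "a = (1 - \<sigma>) * (\<beta> * y) + z"
    by (simp add: a_def y_def z_def)
  have az: "z \<le> a"
    using \<sigma> \<beta> pos by (simp add: ae)
  then show "0 < a" using pos by linarith
  have kz: "2 * m * q \<le> (k - 1) * z"
  proof -
    have "2 * n * r * z \<le> 1 * z"
      using small(2) pos by (intro mult_right_mono) auto
    moreover have "2 * n * r * z = 2 * n"
      using zr by (simp add: mult.commute mult.left_commute)
    moreover have "m * q \<le> n * 1"
      using m q1 pos by (intro mult_mono) auto
    moreover have "1 * z \<le> (k - 1) * z"
      using k pos by (intro mult_right_mono) auto
    ultimately show ?thesis by linarith
  qed
  have X1: "0 \<le> (p - 1) * (f * r\<^sup>2) + (p - 2 + k) * a + 0 * \<sigma> + m * (- (2 * q))"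
  proof -
    have "(p - 1) * (f * r\<^sup>2) + (p - 2 + k) * a
        = (1 - \<sigma>) * (\<beta> * y) * ((p - 1) * \<beta> - (p - k)) + (k - 1) * z"
      unfolding fr ae by algebra
    then show ?thesis
      using kz by (simp add: \<beta>eq)
  qed
  have X2: "- (2 * (p - 2) * q) \<le> f * r\<^sup>2 + k * a + (p - 1) * (0 * \<sigma>) + (p - 2 + m) * (- (2 * q))"
  proof -
    have "f * r\<^sup>2 + k * a = (1 - \<sigma>) * (\<beta> * y) * (\<beta> - 2 + k) + (k - 1) * z"
      unfolding fr ae by algebra
    moreover have "0 \<le> (1 - \<sigma>) * (\<beta> * y) * (\<beta> - 2 + k)"
      using \<sigma> \<beta> pos k by simp
    ultimately show ?thesis
      using kz by (simp add: algebra_simps)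
  qed
  have "q \<le> a * \<beta>"
  proof -
    have "z * r \<le> a * \<beta>"
      using az small(1) pos r by (intro mult_mono) auto
    then show ?thesis
      using q1 zr by linarith
  qed
  then have "0 \<le> 8 * (p - 2) * q\<^sup>2 * \<sigma> * (a * \<beta> - q)"
    using k \<sigma> by simp
  also have "\<dots> = a\<^sup>2 * r\<^sup>2 * 0 + (- (2 * q))\<^sup>2 * \<sigma> * (- (2 * (p - 2) * q))
        + 2 * (p - 2) * a * (- (2 * q)) * (- (2 * \<beta> * y) * r\<^sup>2) * \<sigma>"
    unfolding y(1)[symmetric] by algebra
  also have "\<dots> \<le> p_laplace_form p k m (r\<^sup>2) \<sigma> a (- (2 * q)) f (- (2 * \<beta> * y)) 0"
    unfolding p_laplace_form_def using X1 X2 \<sigma>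
    by (intro add_mono mult_left_mono order.refl) auto
  finally show "0 \<le> p_laplace_form p k m (r\<^sup>2) \<sigma> a (- (2 * r powr \<beta>)) f (- (2 * \<beta> * r powr (\<beta> - 2))) 0"
    by (simp only: q_def y_def)
qed


section \<open>The barriers\<close>

lemma beta_exp_eq: "m \<le> n \<Longrightarrow> beta_exp n m p = (p - real (n - m)) / (p - 1)"
  by (simp add: beta_exp_def of_nat_diff algebra_simps)

lemma p_supersolution_u_hat:
  assumes \<delta>: "\<delta> \<le> 1" "\<delta> \<le> \<gamma> / 2" "real CARD('n::{finite,linorder}) * \<delta> powr \<gamma> \<le> 1"
      "(40 + 16 * real CARD('n)) * \<delta> \<le> \<gamma>\<^sup>2 * (beta_exp CARD('n) m p - \<gamma>)"
    and m: "1 \<le> m" "m + 2 \<le> CARD('n)" and p: "real (CARD('n) - m) < p"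
    and \<gamma>: "0 < \<gamma>" "\<gamma> < beta_exp CARD('n) m p"
  shows "p_supersolution p (dom_G m \<delta> :: (real ^ 'n::{finite,linorder}) set) (u_hat m p \<gamma>)"
proof -
  define \<beta> where "\<beta> = beta_exp CARD('n) m p"
  define G where "G = (dom_G m \<delta> :: (real ^ 'n::{finite,linorder}) set)"
  define r where "r x = norm (fst_part m x)" for x :: "real ^ 'n::{finite,linorder}"
  define \<sigma> where "\<sigma> x = (norm (snd_part m x))\<^sup>2" for x :: "real ^ 'n::{finite,linorder}"
  define a where "a x = \<beta> * r x powr (\<beta> - 2) + \<gamma> * \<sigma> x * r x powr (\<gamma> - 2) - 1" for x
  define b where "b x = 2 * r x powr \<gamma>" for x
  define f where "f x = \<beta> * (\<beta> - 2) * r x powr (\<beta> - 4) + \<gamma> * (\<gamma> - 2) * \<sigma> x * r x powr (\<gamma> - 4)" for x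
  define g where "g x = 2 * \<gamma> * r x powr (\<gamma> - 2)" for x
  have G: "open G"
    unfolding G_def by (rule open_dom_G)
  have r: "0 < r x" "r x < \<delta>" if "x \<in> G" for x
    using that by (auto simp: G_def dom_G_def r_def)
  note C = biradial_C1_const[where m = m and G = G]
  note S = biradial_C1_snd_norm_sq[of m G, folded \<sigma>_def]
  note R = biradial_C1_fst_norm_sq[of m G, folded r_def]
  have P: "biradial_C1 m G (\<lambda>x. r x powr e) (\<lambda>x. e * r x powr (e - 2)) (\<lambda>_. 0)" for e
    unfolding r_def by (rule biradial_C1_fst_norm_powr[OF G]) (use r in \<open>simp add: r_def\<close>)
  have u: "biradial_C1 m G (u_hat m p \<gamma>) a b"
    by (rule biradial_C1_cong[OF biradial_C1_add[OF biradial_C1_add[OF P[of \<beta>] biradial_C1_mult[OF S P[of \<gamma>]]]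
          biradial_C1_mult[OF C[of "- 1 / 2"] R]] G])
      (simp_all add: u_hat_def a_def b_def r_def \<sigma>_def \<beta>_def)
  have a: "biradial_C1 m G a f g"
    by (rule biradial_C1_cong[OF biradial_C1_add[OF biradial_C1_add[OF biradial_C1_mult[OF C[of \<beta>] P[of "\<beta> - 2"]]
          biradial_C1_mult[OF biradial_C1_mult[OF C[of \<gamma>] S] P[of "\<gamma> - 2"]]] C[of "- 1"]] G])
      (simp_all add: a_def f_def g_def)
  have b: "biradial_C1 m G b g (\<lambda>_. 0)"
    by (rule biradial_C1_cong[OF biradial_C1_mult[OF C[of 2] P[of \<gamma>]] G]) (simp_all add: b_def g_def)
  have sign: "0 < a x" "p_laplace_form p (real (CARD('n) - m)) (real m) ((r x)\<^sup>2) (\<sigma> x) (a x) (b x) (f x) (g x) 0 \<le> 0"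
    if x: "x \<in> G" for x
  proof -
    have \<beta>: "\<beta> = (p - real (CARD('n) - m)) / (p - 1)"
      unfolding \<beta>_def using m by (intro beta_exp_eq) simp
    have "real CARD('n) * r x powr \<gamma> \<le> real CARD('n) * \<delta> powr \<gamma>"
      using r[OF x] \<gamma> by (intro mult_left_mono powr_mono2) auto
    then have 1: "real CARD('n) * r x powr \<gamma> \<le> 1"
      using \<delta> by linarith
    have "(40 + 16 * real CARD('n)) * r x \<le> (40 + 16 * real CARD('n)) * \<delta>"
      using r[OF x] by (intro mult_left_mono) auto
    then have 2: "(40 + 16 * real CARD('n)) * r x \<le> \<gamma>\<^sup>2 * (\<beta> - \<gamma>)"
      using \<delta> by (simp only: \<beta>_def)
    note L = p_laplace_form_u_hat_nonpos[of "r x" "\<sigma> x" "real (CARD('n) - m)" p "real m" "real CARD('n)" \<gamma>,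
        folded \<beta>, folded a_def b_def f_def g_def]
    show "0 < a x" "p_laplace_form p (real (CARD('n) - m)) (real m) ((r x)\<^sup>2) (\<sigma> x) (a x) (b x) (f x) (g x) 0 \<le> 0"
      by (rule L; use r[OF x] \<delta> m p \<gamma> 1 2 in \<open>simp add: \<sigma>_def \<beta>_def\<close>)+
  qed
  show ?thesis
    unfolding G_def[symmetric]
    by (rule biradial_p_subsolution_p_supersolution(2)[OF G _ _ u a b])
      (use sign r p m in \<open>force simp: r_def \<sigma>_def\<close>)+
qed

lemma p_subsolution_u_check:
  assumes \<delta>: "\<delta> \<le> 1" "\<delta> \<le> beta_exp CARD('n::{finite,linorder}) m p" "2 * real CARD('n) * \<delta> \<le> 1"
    and m: "1 \<le> m" "m + 2 \<le> CARD('n)" and p: "real (CARD('n) - m) < p"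
  shows "p_subsolution p (dom_G m \<delta> :: (real ^ 'n::{finite,linorder}) set) (u_check m p)"
proof -
  define \<beta> where "\<beta> = beta_exp CARD('n) m p"
  define G where "G = (dom_G m \<delta> :: (real ^ 'n::{finite,linorder}) set)"
  define r where "r x = norm (fst_part m x)" for x :: "real ^ 'n::{finite,linorder}"
  define \<sigma> where "\<sigma> x = (norm (snd_part m x))\<^sup>2" for x :: "real ^ 'n::{finite,linorder}"
  define a where "a x = (1 - \<sigma> x) * (\<beta> * r x powr (\<beta> - 2)) + r x powr (-1)" for x
  define b where "b x = - (2 * r x powr \<beta>)" for x
  define f where "f x = (1 - \<sigma> x) * (\<beta> * (\<beta> - 2) * r x powr (\<beta> - 4)) - r x powr (-3)" for x
  define g where "g x = - (2 * \<beta> * r x powr (\<beta> - 2))" for x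
  have G: "open G"
    unfolding G_def by (rule open_dom_G)
  have r: "0 < r x" "r x < \<delta>" and \<sigma>: "\<sigma> x \<le> 1" if "x \<in> G" for x
    using that by (auto simp: G_def dom_G_def r_def \<sigma>_def power_le_one)
  note C = biradial_C1_const[where m = m and G = G]
  note S = biradial_C1_snd_norm_sq[of m G, folded \<sigma>_def]
  have P: "biradial_C1 m G (\<lambda>x. r x powr e) (\<lambda>x. e * r x powr (e - 2)) (\<lambda>_. 0)" for e
    unfolding r_def by (rule biradial_C1_fst_norm_powr[OF G]) (use r in \<open>simp add: r_def\<close>)
  note S' = biradial_C1_add[OF C[of 1] biradial_C1_mult[OF C[of "- 1"] S]]
  have u: "biradial_C1 m G (u_check m p) a b"
    by (rule biradial_C1_cong[OF biradial_C1_add[OF biradial_C1_mult[OF S' P[of \<beta>]] P[of 1]] G])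
      (use r in \<open>simp_all add: u_check_def a_def b_def r_def \<sigma>_def \<beta>_def\<close>)
  have a: "biradial_C1 m G a f g"
    by (rule biradial_C1_cong[OF biradial_C1_add[OF biradial_C1_mult[OF S'
            biradial_C1_mult[OF C[of \<beta>] P[of "\<beta> - 2"]]] P[of "- 1"]] G])
      (simp_all add: a_def f_def g_def)
  have b: "biradial_C1 m G b g (\<lambda>_. 0)"
    by (rule biradial_C1_cong[OF biradial_C1_mult[OF C[of "- 2"] P[of \<beta>]] G]) (simp_all add: b_def g_def)
  have \<beta>: "\<beta> = (p - real (CARD('n) - m)) / (p - 1)"
    unfolding \<beta>_def using m by (intro beta_exp_eq) simp
  have k: "2 \<le> real (CARD('n) - m)"
    using m by simp
  then have \<beta>pos: "0 < \<beta>"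
    unfolding \<beta> using p by simp
  have sign: "0 < a x" "0 \<le> p_laplace_form p (real (CARD('n) - m)) (real m) ((r x)\<^sup>2) (\<sigma> x) (a x) (b x) (f x) (g x) 0"
    if x: "x \<in> G" for x
  proof -
    have "2 * real CARD('n) * r x \<le> 2 * real CARD('n) * \<delta>"
      using r[OF x] by (intro mult_left_mono) auto
    then have 1: "2 * real CARD('n) * r x \<le> 1"
      using \<delta> by linarith
    have 2: "r x \<le> \<beta>" "r x \<le> 1"
      using r[OF x] \<delta> by (simp_all add: \<beta>_def)
    note L = p_laplace_form_u_check_nonneg[of "r x" "\<sigma> x" "real (CARD('n) - m)" p "real m" "real CARD('n)",
        folded \<beta>, folded a_def b_def f_def g_def]
    have [simp]: "0 \<le> \<sigma> x"
      by (simp add: \<sigma>_def)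
    show "0 < a x" "0 \<le> p_laplace_form p (real (CARD('n) - m)) (real m) ((r x)\<^sup>2) (\<sigma> x) (a x) (b x) (f x) (g x) 0"
      by (rule L; use r[OF x] \<sigma>[OF x] k m p \<beta>pos 1 2 in simp)+
  qed
  show ?thesis
    unfolding G_def[symmetric]
    by (rule biradial_p_subsolution_p_supersolution(1)[OF G _ _ u a b])
      (use sign r p m in \<open>force simp: r_def \<sigma>_def\<close>)+
qed

text \<open>The smallness conditions on the radius see \<open>p\<close> and \<open>m\<close> only through the gap \<open>\<beta> - \<gamma>\<close>, so a lower
  bound \<open>d\<close> for it is what both halves of the theorem have to supply.\<close>

lemma barrier_radius:
  assumes "0 < \<gamma>" "0 < d"
  shows "\<exists>\<delta>. 0 < \<delta> \<and> \<delta> < 1 \<and> (\<forall>p. \<forall>m::nat. 1 \<le> m \<and> m + 2 \<le> CARD('n::{finite,linorder}) \<and>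
      real (CARD('n) - m) < p \<and> \<gamma> + d \<le> beta_exp CARD('n) m p \<longrightarrow>
      p_supersolution p (dom_G m \<delta> :: (real ^ 'n::{finite,linorder}) set) (u_hat m p \<gamma>) \<and>
      p_subsolution p (dom_G m \<delta> :: (real ^ 'n::{finite,linorder}) set) (u_check m p))"
proof -
  define n where "n = real CARD('n)"
  have n: "0 < n"
    by (simp add: n_def)
  define \<delta> where "\<delta> = Min {1 / 2, \<gamma> / 2, n powr (- 1 / \<gamma>), \<gamma>\<^sup>2 * d / (40 + 16 * n), 1 / (2 * n)}"
  have pos: "0 < \<delta>"
    unfolding \<delta>_def using assms n by (subst Min_gr_iff) auto
  have le: "\<delta> \<le> 1 / 2" "\<delta> \<le> \<gamma> / 2" "\<delta> \<le> n powr (- 1 / \<gamma>)" "\<delta> \<le> \<gamma>\<^sup>2 * d / (40 + 16 * n)" "\<delta> \<le> 1 / (2 * n)"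
    unfolding \<delta>_def by (rule Min_le; simp)+
  have "\<delta> powr \<gamma> \<le> (n powr (- 1 / \<gamma>)) powr \<gamma>"
    using pos le assms by (intro powr_mono2) auto
  also have "\<dots> = n powr (- 1)"
    using assms by (simp only: powr_powr) simp
  also have "\<dots> = 1 / n"
    using n by (simp add: powr_minus divide_inverse)
  finally have 1: "n * \<delta> powr \<gamma> \<le> 1"
    using n by (simp add: field_simps)
  have 2: "(40 + 16 * n) * \<delta> \<le> \<gamma>\<^sup>2 * d" "2 * n * \<delta> \<le> 1"
    using le(4,5) n by (simp_all add: field_simps)
  have "p_supersolution p (dom_G m \<delta> :: (real ^ 'n::{finite,linorder}) set) (u_hat m p \<gamma>) \<and>
      p_subsolution p (dom_G m \<delta> :: (real ^ 'n::{finite,linorder}) set) (u_check m p)"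
    if m: "1 \<le> m" "m + 2 \<le> CARD('n)" and p: "real (CARD('n) - m) < p"
      and d: "\<gamma> + d \<le> beta_exp CARD('n) m p" for p m
  proof
    have "\<gamma>\<^sup>2 * d \<le> \<gamma>\<^sup>2 * (beta_exp CARD('n) m p - \<gamma>)"
      using d by (intro mult_left_mono) auto
    with 2(1) have "(40 + 16 * n) * \<delta> \<le> \<gamma>\<^sup>2 * (beta_exp CARD('n) m p - \<gamma>)"
      by linarith
    then show "p_supersolution p (dom_G m \<delta> :: (real ^ 'n::{finite,linorder}) set) (u_hat m p \<gamma>)"
      using m p d assms le 1 by (intro p_supersolution_u_hat) (auto simp: n_def)
    show "p_subsolution p (dom_G m \<delta> :: (real ^ 'n::{finite,linorder}) set) (u_check m p)"
      using m p d assms le 1 2 by (intro p_subsolution_u_check) (auto simp: n_def)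
  qed
  then show ?thesis
    using pos le(1) by (intro exI[of _ \<delta>]) auto
qed

lemma beta_exp_lt_1:
  assumes "m + 2 \<le> n" "real (n - m) < p"
  shows "beta_exp n m p < 1"
  using assms by (simp add: beta_exp_eq field_simps of_nat_diff)

text \<open>Since \<open>1 - \<beta> = (n - m - 1)/(p - 1)\<close>, the exponent tends to \<open>1\<close> as \<open>p \<rightarrow> \<infinity>\<close>, uniformly in \<open>m\<close>.\<close>

lemma beta_exp_ge:
  assumes "m + 2 \<le> n" "real (n - m) < p" "0 < c" "1 + real n / c \<le> p"
  shows "1 - c \<le> beta_exp n m p"
proof -
  have p: "1 < p"
    using assms(1,2) by linarith
  have "real n \<le> c * (p - 1)"
    using assms(3,4) by (simp add: field_simps)
  then have "(1 - c) * (p - 1) \<le> p - real (n - m)"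
    using assms(1) by (simp add: of_nat_diff algebra_simps)
  then show ?thesis
    using assms(1) p by (simp add: beta_exp_eq pos_le_divide_eq)
qed

theorem lemma4:
  fixes \<gamma> :: real
  assumes "0 < \<gamma>"
  shows "(\<forall>p::real. \<exists>\<delta>\<^sub>c. 0 < \<delta>\<^sub>c \<and> \<delta>\<^sub>c < 1 \<and>
            (\<forall>m::nat. 1 \<le> m \<and> m + 2 \<le> CARD('n::{finite,linorder}) \<and>
               real (CARD('n::{finite,linorder}) - m) < p \<and> \<gamma> < beta_exp CARD('n::{finite,linorder}) m p \<longrightarrow>
               p_supersolution p (dom_G m \<delta>\<^sub>c :: (real ^ 'n::{finite,linorder}) set) (u_hat m p \<gamma>) \<and>
               p_subsolution p (dom_G m \<delta>\<^sub>c :: (real ^ 'n::{finite,linorder}) set) (u_check m p)))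
       \<and> (1 / 2 < \<gamma> \<longrightarrow>
            (\<exists>p\<^sub>0::real. \<exists>\<delta>\<^sub>c. 0 < \<delta>\<^sub>c \<and> \<delta>\<^sub>c < 1 \<and>
               (\<forall>p\<ge>p\<^sub>0. \<forall>m::nat. 1 \<le> m \<and> m + 2 \<le> CARD('n::{finite,linorder}) \<and>
                  real (CARD('n::{finite,linorder}) - m) < p \<and> \<gamma> < beta_exp CARD('n::{finite,linorder}) m p \<longrightarrow>
                  p_supersolution p (dom_G m \<delta>\<^sub>c :: (real ^ 'n::{finite,linorder}) set) (u_hat m p \<gamma>) \<and>
                  p_subsolution p (dom_G m \<delta>\<^sub>c :: (real ^ 'n::{finite,linorder}) set) (u_check m p))))"
    (is "(\<forall>p. \<exists>\<delta>. 0 < \<delta> \<and> \<delta> < 1 \<and> (\<forall>m. ?A p m \<longrightarrow> ?S p m \<delta>)) \<and> (_ \<longrightarrow> ?large)")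
proof (intro conjI allI impI)
  fix p :: real
  (* For fixed p only finitely many m occur, so the gaps \<beta> - \<gamma> have a positive minimum. *)
  define D where "D = insert 1 {beta_exp CARD('n) m p - \<gamma> | m. m \<in> {..CARD('n)} \<and> \<gamma> < beta_exp CARD('n) m p}"
  have "finite D"
    unfolding D_def by simp
  then have "0 < Min D"
    by (subst Min_gr_iff) (auto simp: D_def)
  then obtain \<delta> where \<delta>: "0 < \<delta>" "\<delta> < 1" and sol: "\<And>p m. 1 \<le> m \<and> m + 2 \<le> CARD('n) \<and>
      real (CARD('n) - m) < p \<and> \<gamma> + Min D \<le> beta_exp CARD('n) m p \<Longrightarrow> ?S p m \<delta>"
    using barrier_radius[OF assms, where 'n = 'n] by blast
  have "?S p m \<delta>" if "?A p m" for m
  proof (rule sol)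
    have "Min D \<le> beta_exp CARD('n) m p - \<gamma>"
      using that by (intro Min_le[OF \<open>finite D\<close>]) (auto simp: D_def)
    then show "1 \<le> m \<and> m + 2 \<le> CARD('n) \<and> real (CARD('n) - m) < p \<and> \<gamma> + Min D \<le> beta_exp CARD('n) m p"
      using that by linarith
  qed
  with \<delta> show "\<exists>\<delta>. 0 < \<delta> \<and> \<delta> < 1 \<and> (\<forall>m. ?A p m \<longrightarrow> ?S p m \<delta>)"
    by blast
next
  show ?large
  proof (cases "\<gamma> < 1")
    case True
    (* As \<beta> tends to 1, eventually \<beta> \<ge> 1 - c, which leaves the gap c between \<gamma> and \<beta>. *)
    define c where "c = (1 - \<gamma>) / 2"
    have c: "0 < c" "\<gamma> + c = 1 - c"
      using True by (simp_all add: c_def field_simps)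
    obtain \<delta> where \<delta>: "0 < \<delta>" "\<delta> < 1" and sol: "\<And>p m. 1 \<le> m \<and> m + 2 \<le> CARD('n) \<and>
        real (CARD('n) - m) < p \<and> \<gamma> + c \<le> beta_exp CARD('n) m p \<Longrightarrow> ?S p m \<delta>"
      using barrier_radius[OF assms c(1), where 'n = 'n] by blast
    have "?S p m \<delta>" if "1 + real CARD('n) / c \<le> p" "?A p m" for p m
      using that c beta_exp_ge[of m "CARD('n)" p c] by (intro sol) auto
    with \<delta> show ?thesis
      by blast
  next
    case False
    then have "\<not> ?A p m" for p m
      using beta_exp_lt_1[of m "CARD('n)" p] by auto
    then show ?thesis
      by (intro exI[of _ 0] exI[of _ "1 / 2"]) auto
  qed
qed

end
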